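(* There is a polynomial time algorithm which, given a graph $G$ with maximum degree three, determines whether $\overleftrightarrow{\chi}(G) \leq 2$.
   Context: All graphs are finite and simple. An orientation $D$ of a graph $G$ is a digraph obtained by replacing each edge of $G$ by exactly one of the two possible arcs with the same endvertices. For a vertex $v$, $d_D^-(v)$ (in-degree) is the number of arcs with head $v$, $d_D^+(v)$ (out-degree) is the number of arcs with tail $v$, and the in-out-degree is $d_D^{\pm}(v) = d_D^-(v) - d_D^+(v)$. An orientation $D$ of $G$ is in-out-proper if $d_D^{\pm}(u) \neq d_D^{\pm}(v)$ for any two adjacent vertices $u,v$. The in-out-proper orientation number of $G$ is $\overleftrightarrow{\chi}(G) = \min_{D\in\Gamma}\max_{v\in V(G)} |d_D^{\pm}(v)|$, where $\Gamma$ is the set of in-out-proper orientations of $G$ (it is known that $\Gamma$ is nonempty for every graph $G$). *)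

theory Defs
  imports "Graph_Theory.Pair_Digraph" "HOL-Computational_Algebra.Polynomial"
begin

section \<open>In-out-proper orientations\<close>

text \<open>
  As everywhere in the graph library, a finite simple graph is a finite, loop-free, symmetric
  digraph without parallel arcs (locale \<^locale>\<open>pair_graph\<close>): the undirected edge
  $uv$ is the pair of arcs $(u,v)$, $(v,u)$. The undirected degree of a vertex is then its
  out-degree.
\<close>

definition max_degree :: "'a pair_pre_digraph \<Rightarrow> nat" where
  "max_degree G = Max (insert 0 (out_degree (with_proj G) ` pverts G))"

definition orientation :: "'a pair_pre_digraph \<Rightarrow> 'a pair_pre_digraph \<Rightarrow> bool" where
  "orientation G D \<longleftrightarrow> pverts D = pverts G \<and> parcs D \<subseteq> parcs G \<and>
     (\<forall>(u, v) \<in> parcs G. (u, v) \<in> parcs D \<longleftrightarrow> (v, u) \<notin> parcs D)"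

definition in_out_degree :: "'a pair_pre_digraph \<Rightarrow> 'a \<Rightarrow> int" where
  "in_out_degree D v = int (in_degree (with_proj D) v) - int (out_degree (with_proj D) v)"

definition in_out_proper :: "'a pair_pre_digraph \<Rightarrow> 'a pair_pre_digraph \<Rightarrow> bool" where
  "in_out_proper G D \<longleftrightarrow> orientation G D \<and>
     (\<forall>(u, v) \<in> parcs G. in_out_degree D u \<noteq> in_out_degree D v)"

text \<open>The element 0 only matters for the graph without vertices (here and in
  \<^const>\<open>max_degree\<close>).\<close>

definition max_in_out_degree :: "'a pair_pre_digraph \<Rightarrow> nat" where
  "max_in_out_degree D = Max (insert 0 ((\<lambda>v. nat \<bar>in_out_degree D v\<bar>) ` pverts D))"

definition in_out_proper_orientation_number :: "'a pair_pre_digraph \<Rightarrow> nat" where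
  "in_out_proper_orientation_number G = Min (max_in_out_degree ` {D. in_out_proper G D})"

section \<open>Polynomial time\<close>

text \<open>
  Algorithms are while programs over a random-access memory of natural numbers. The memory is
  divided into named arrays, of which a program uses only finitely many; the cell
  \<open>x[0]\<close> serves as the scalar variable \<open>x\<close>.

  Every assignment and every test costs one time unit. This is a polynomially faithful cost
  measure: a program contains finitely many expressions of fixed size, and the only arithmetic
  is addition and truncated subtraction, so a step increases the bit length of the largest
  number in memory by at most a constant depending on the program. Hence $t$ steps can be
  simulated by a Turing machine in time polynomial in $t$ and the input length, and vice versa.
\<close>

type_synonym vname = string
type_synonym state = "vname \<Rightarrow> nat \<Rightarrow> nat"

datatype aexp = N nat | Rd vname aexp | Plus aexp aexp | Minus aexp aexp

datatype bexp = Less aexp aexp | Eq aexp aexp | Not bexp | And bexp bexp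

datatype com =
    Skip
  | Assign vname aexp aexp  \<comment> \<open>\<open>x[a] := b\<close>\<close>
  | Seq com com
  | If bexp com com
  | While bexp com

primrec aval :: "aexp \<Rightarrow> state \<Rightarrow> nat" where
  "aval (N n) s = n"
| "aval (Rd x a) s = s x (aval a s)"
| "aval (Plus a b) s = aval a s + aval b s"
| "aval (Minus a b) s = aval a s - aval b s"

primrec bval :: "bexp \<Rightarrow> state \<Rightarrow> bool" where
  "bval (Less a b) s \<longleftrightarrow> aval a s < aval b s"
| "bval (Eq a b) s \<longleftrightarrow> aval a s = aval b s"
| "bval (Not b) s \<longleftrightarrow> \<not> bval b s"
| "bval (And b c) s \<longleftrightarrow> bval b s \<and> bval c s"

text \<open>\<open>exec c s t s'\<close>: started in \<open>s\<close>, the program \<open>c\<close> halts in \<open>s'\<close> after exactly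
  \<open>t\<close> time units.\<close>

inductive exec :: "com \<Rightarrow> state \<Rightarrow> nat \<Rightarrow> state \<Rightarrow> bool" where
  Skip: "exec Skip s 1 s"
| Assign: "exec (Assign x a b) s 1 (s(x := (s x)(aval a s := aval b s)))"
| Seq: "exec c s t s' \<Longrightarrow> exec d s' t' s'' \<Longrightarrow> exec (Seq c d) s (t + t') s''"
| IfTrue: "bval b s \<Longrightarrow> exec c s t s' \<Longrightarrow> exec (If b c d) s (Suc t) s'"
| IfFalse: "\<not> bval b s \<Longrightarrow> exec d s t s' \<Longrightarrow> exec (If b c d) s (Suc t) s'"
| WhileFalse: "\<not> bval b s \<Longrightarrow> exec (While b c) s 1 s"
| WhileTrue: "bval b s \<Longrightarrow> exec c s t s' \<Longrightarrow> exec (While b c) s' t' s'' \<Longrightarrow>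
    exec (While b c) s (Suc (t + t')) s''"

lemma exec_deterministic:
  "exec c s t s' \<Longrightarrow> exec c s u s'' \<Longrightarrow> u = t \<and> s'' = s'"
proof (induction arbitrary: u s'' rule: exec.induct)
  case (Seq c s t s' d t' r)
  from Seq.prems show ?case by cases (use Seq.IH in blast)
next
  case (IfTrue b s c t s' d)
  from IfTrue.prems show ?case by cases (use IfTrue in blast)+
next
  case (IfFalse b s d t s' c)
  from IfFalse.prems show ?case by cases (use IfFalse in blast)+
next
  case (WhileTrue b s c t s' t' r)
  from WhileTrue.prems show ?case by cases (use WhileTrue in blast)+
next
  case (WhileFalse b s c)
  from WhileFalse.prems show ?case by cases (use WhileFalse.hyps in auto)
qed (auto elim: exec.cases)

text \<open>The input is a bit string, stored together with its length; all other cells are 0.\<close>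

definition input_state :: "bool list \<Rightarrow> state" where
  "input_state w = (\<lambda>x i.
     if x = ''len'' \<and> i = 0 then length w
     else if x = ''in'' \<and> i < length w then of_bool (w ! i)
     else 0)"

definition accepting :: "state \<Rightarrow> bool" where
  "accepting s \<longleftrightarrow> s ''out'' 0 = 1"

text \<open>
  The algorithm has to be correct and fast on the given class of instances only; nothing is
  required on other bit strings. Time is measured in the length of the bit string.
\<close>

definition poly_time_decidable_on :: "('i \<Rightarrow> bool list) \<Rightarrow> 'i set \<Rightarrow> ('i \<Rightarrow> bool) \<Rightarrow> bool" where
  "poly_time_decidable_on enc I P \<longleftrightarrow>
     (\<exists>(c :: com) (p :: nat poly). \<forall>x\<in>I. \<exists>t s.
        exec c (input_state (enc x)) t s \<and>
        t \<le> poly p (length (enc x)) \<and>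
        (accepting s \<longleftrightarrow> P x))"

text \<open>As inputs, graphs have vertices \<open>0, \<dots>, n - 1\<close> and are given by the \<open>n\<^sup>2\<close> entries of
  their adjacency matrix, row by row.\<close>

definition input_graph :: "nat pair_pre_digraph \<Rightarrow> bool" where
  "input_graph G \<longleftrightarrow> pair_graph G \<and> (\<exists>n. pverts G = {..<n})"

definition adjacency_string :: "nat pair_pre_digraph \<Rightarrow> bool list" where
  "adjacency_string G =
     (let n = card (pverts G) in [(i, j) \<in> parcs G. i \<leftarrow> [0..<n], j \<leftarrow> [0..<n]])"

end

theory Submission
  imports Defs
begin

text \<open>
  Let \<open>G\<close> have maximum degree three. In an in-out-proper orientation with in-out-degrees at
  most 2 in absolute value, the vertices of odd degree have in-out-degree 1 or -1, with opposite
  signs at adjacent ones. So the graph on these vertices is 2-coloured by the signs, and each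
  vertex of degree 3 has exactly one arc against the majority. Between vertices of odd degree,
  these minority arcs form a matching of the vertices of degree 3, and it can miss only vertices
  that have a neighbour of degree 2. Conversely, a colouring and a matching determine an
  orientation of all edges at vertices of odd degree. The edges between vertices of degree 2 are
  then oriented so as to maximise the sum of the squared in-out-degrees, since reversing an arc
  between vertices of equal in-out-degree increases this sum. The same argument shows that
  in-out-proper orientations exist at all.

  By a theorem of Mendelsohn and Dulmage, the matching exists as soon as the vertices of
  degree 3 without a neighbour of degree 2 have distinct representatives among their neighbours
  of degree 3. The algorithm finds the 2-colouring by merging components edge by edge, and the
  representatives by an auction, whose prices never exceed the number of vertices if
  representatives exist.
\<close>

section \<open>Orientations of graphs of maximum degree three\<close>

lemma in_degree_with_proj: "in_degree (with_proj D) v = card {w. (w, v) \<in> parcs D}"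
proof -
  have "in_arcs (with_proj D) v = (\<lambda>w. (w, v)) ` {w. (w, v) \<in> parcs D}"
    by (auto simp: in_arcs_def)
  then show ?thesis
    by (simp add: in_degree_def card_image inj_on_def)
qed

lemma out_degree_with_proj: "out_degree (with_proj D) v = card {w. (v, w) \<in> parcs D}"
proof -
  have "out_arcs (with_proj D) v = Pair v ` {w. (v, w) \<in> parcs D}"
    by (auto simp: out_arcs_def)
  then show ?thesis
    by (simp add: out_degree_def card_image inj_on_def)
qed

definition deg :: "'a pair_pre_digraph \<Rightarrow> 'a \<Rightarrow> nat" where
  "deg G v = card {w. (v, w) \<in> parcs G}"

lemma in_out_degree_card:
  "in_out_degree D v = int (card {w. (w, v) \<in> parcs D}) - int (card {w. (v, w) \<in> parcs D})"
  by (simp add: in_out_degree_def in_degree_with_proj out_degree_with_proj)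

text \<open>The colours stand for the signs of the in-out-degrees at the vertices of odd degree.\<close>

definition sign_colouring :: "'a pair_pre_digraph \<Rightarrow> ('a \<Rightarrow> bool) \<Rightarrow> bool" where
  "sign_colouring G c \<longleftrightarrow>
     (\<forall>(u, v) \<in> parcs G. deg G u \<noteq> 2 \<longrightarrow> deg G v \<noteq> 2 \<longrightarrow> c u \<noteq> c v)"

lemma sign_colouringD:
  assumes "sign_colouring G c" "(u, v) \<in> parcs G" "deg G u \<noteq> 2" "deg G v \<noteq> 2"
  shows "c u \<noteq> c v"
  using assms unfolding sign_colouring_def by blast

text \<open>Those vertices of degree 3 whose single arc against the majority has no neighbour of
  degree 2 to go to.\<close>

definition core :: "'a pair_pre_digraph \<Rightarrow> 'a set" where
  "core G = {u \<in> pverts G. deg G u = 3 \<and> (\<forall>v. (u, v) \<in> parcs G \<longrightarrow> deg G v \<noteq> 2)}"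

text \<open>Distinct representatives instead of a matching: \<open>f\<close> need not map back. They
  can be found by an auction, and a matching is extracted from them later.\<close>

definition core_representatives :: "'a pair_pre_digraph \<Rightarrow> ('a \<Rightarrow> 'a) \<Rightarrow> bool" where
  "core_representatives G f \<longleftrightarrow>
     inj_on f (core G) \<and> (\<forall>u\<in>core G. (u, f u) \<in> parcs G \<and> deg G (f u) = 3)"

section \<open>Orientations and the reversal of an arc\<close>

context pair_graph
begin

lemma arcs_sym: "(u, v) \<in> parcs G \<longleftrightarrow> (v, u) \<in> parcs G"
  using arcs_symmetric by blast

lemma finite_orientations: "finite {D. orientation G D}"
proof (rule finite_subset)
  show "{D. orientation G D} \<subseteq>
      (\<lambda>A. \<lparr>pverts = pverts G, parcs = A\<rparr>) ` Pow (parcs G)"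
    by (auto simp: orientation_def image_iff intro!: pair_pre_digraph.equality)
  show "finite ((\<lambda>A. \<lparr>pverts = pverts G, parcs = A\<rparr>) ` Pow (parcs G))"
    using pair_finite_arcs by simp
qed

lemma finite_neighbours:
  assumes "orientation G D"
  shows "finite {w. (w, v) \<in> parcs D}" "finite {w. (v, w) \<in> parcs D}"
proof -
  have "{w. (w, v) \<in> parcs D} \<subseteq> pverts G" "{w. (v, w) \<in> parcs D} \<subseteq> pverts G"
    using assms in_arcsD1 in_arcsD2 by (auto simp: orientation_def)
  then show "finite {w. (w, v) \<in> parcs D}" "finite {w. (v, w) \<in> parcs D}"
    using pair_finite_verts finite_subset by blast+
qed

lemma finite_out_neighbours: "finite {w. (v, w) \<in> parcs G}"
  by (rule finite_subset[OF _ pair_finite_verts]) (auto dest: in_arcsD2)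

lemma deg_pos:
  assumes "(u, v) \<in> parcs G"
  shows "deg G u \<noteq> 0" "deg G v \<noteq> 0"
  using assms arcs_sym[of u v] finite_out_neighbours[of u] finite_out_neighbours[of v] unfolding deg_def
  by (auto simp: card_eq_0_iff)

lemma orientation_iff:
  assumes "orientation G D" "(u, v) \<in> parcs G"
  shows "(u, v) \<in> parcs D \<longleftrightarrow> (v, u) \<notin> parcs D"
  using assms by (auto simp: orientation_def)

lemma orientation_arc:
  assumes "orientation G D" "(u, v) \<in> parcs D"
  shows "(u, v) \<in> parcs G" "(v, u) \<in> parcs G" "(v, u) \<notin> parcs D"
  using assms arcs_sym by (auto simp: orientation_def)

text \<open>In- and out-neighbours partition the neighbours. In particular, the in-out-degree has
  the parity of the degree.\<close>

lemma in_out_card_sum: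
  assumes "orientation G D"
  shows "card {w. (w, v) \<in> parcs D} + card {w. (v, w) \<in> parcs D} = deg G v"
proof -
  have "{w. (v, w) \<in> parcs G} = {w. (w, v) \<in> parcs D} \<union> {w. (v, w) \<in> parcs D}"
    using orientation_arc[OF assms] orientation_iff[OF assms] by blast
  moreover have "{w. (w, v) \<in> parcs D} \<inter> {w. (v, w) \<in> parcs D} = {}"
    using orientation_arc(3)[OF assms] by blast
  ultimately show ?thesis
    using finite_neighbours[OF assms, of v] by (simp add: deg_def card_Un_disjoint)
qed

definition reverse_arc :: "'a \<Rightarrow> 'a \<Rightarrow> 'a pair_pre_digraph \<Rightarrow> 'a pair_pre_digraph" where
  "reverse_arc u v D = D\<lparr>parcs := insert (v, u) (parcs D - {(u, v)})\<rparr>"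

lemma orientation_reverse_arc:
  assumes "orientation G D" "(u, v) \<in> parcs D"
  shows "orientation G (reverse_arc u v D)"
proof -
  have "u \<noteq> v" using orientation_arc(1)[OF assms] no_loops' by blast
  have "(x, y) \<in> parcs (reverse_arc u v D) \<longleftrightarrow> (y, x) \<notin> parcs (reverse_arc u v D)"
    if "(x, y) \<in> parcs G" for x y
    using orientation_iff[OF assms(1) that] orientation_arc(3)[OF assms] assms(2) \<open>u \<noteq> v\<close>
    by (cases "(x, y) = (u, v)"; cases "(x, y) = (v, u)") (auto simp: reverse_arc_def)
  moreover have "parcs (reverse_arc u v D) \<subseteq> parcs G" "pverts (reverse_arc u v D) = pverts G"
    using assms(1) orientation_arc(2)[OF assms] by (auto simp: orientation_def reverse_arc_def)
  ultimately show ?thesis by (auto simp: orientation_def)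
qed

lemma in_out_degree_reverse_arc:
  assumes D: "orientation G D" and uv: "(u, v) \<in> parcs D"
  shows "in_out_degree (reverse_arc u v D) u = in_out_degree D u + 2"
    and "in_out_degree (reverse_arc u v D) v = in_out_degree D v - 2"
    and "w \<noteq> u \<Longrightarrow> w \<noteq> v \<Longrightarrow> in_out_degree (reverse_arc u v D) w = in_out_degree D w"
proof -
  let ?D = "reverse_arc u v D"
  have ne: "u \<noteq> v" and vu: "(v, u) \<notin> parcs D"
    using orientation_arc[OF D uv] no_loops' by auto
  note fin = finite_neighbours[OF D]
  have "{w. (w, u) \<in> parcs ?D} = insert v {w. (w, u) \<in> parcs D}"
    "{w. (u, w) \<in> parcs ?D} = {w. (u, w) \<in> parcs D} - {v}"
    using ne by (auto simp: reverse_arc_def)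
  moreover have "card {w. (u, w) \<in> parcs D} = Suc (card ({w. (u, w) \<in> parcs D} - {v}))"
    using uv fin by (subst card_Suc_Diff1) auto
  ultimately show "in_out_degree ?D u = in_out_degree D u + 2"
    using vu fin by (simp add: in_out_degree_card)
  have "{w. (w, v) \<in> parcs ?D} = {w. (w, v) \<in> parcs D} - {u}"
    "{w. (v, w) \<in> parcs ?D} = insert u {w. (v, w) \<in> parcs D}"
    using ne by (auto simp: reverse_arc_def)
  moreover have "card {w. (w, v) \<in> parcs D} = Suc (card ({w. (w, v) \<in> parcs D} - {u}))"
    using uv fin by (subst card_Suc_Diff1) auto
  ultimately show "in_out_degree ?D v = in_out_degree D v - 2"
    using vu fin by (simp add: in_out_degree_card)
  show "in_out_degree ?D w = in_out_degree D w" if "w \<noteq> u" "w \<noteq> v"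
  proof -
    have "{x. (x, w) \<in> parcs ?D} = {x. (x, w) \<in> parcs D}"
      "{x. (w, x) \<in> parcs ?D} = {x. (w, x) \<in> parcs D}"
      using that by (auto simp: reverse_arc_def)
    then show ?thesis by (simp add: in_out_degree_card)
  qed
qed

text \<open>Maximise the sum of the squared in-out-degrees: reversing an arc between two vertices
  of equal in-out-degree would increase it by 8.\<close>

lemma proper_on_free_edges:
  assumes D0: "orientation G D0" and F: "sym F" "F \<subseteq> parcs G"
  obtains D where "orientation G D" "parcs D - F = parcs D0 - F"
    "\<And>u v. (u, v) \<in> F \<Longrightarrow> in_out_degree D u \<noteq> in_out_degree D v"
proof -
  \<comment> \<open>Candidates differ from \<open>D0\<close> on \<open>F\<close> only. As
    \<open>F\<close> is symmetric, reversing an arc of \<open>F\<close> gives another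
    candidate.\<close>
  let ?C = "{D. orientation G D \<and> parcs D - F = parcs D0 - F}"
  define S where "S D = (\<Sum>w\<in>pverts G. (in_out_degree D w)\<^sup>2)" for D
  have fin: "finite ?C"
    using finite_orientations by (rule rev_finite_subset) auto
  have "D0 \<in> ?C" using D0 by simp
  then have ne: "S ` ?C \<noteq> {}" by blast
  have "Max (S ` ?C) \<in> S ` ?C" using fin ne by (intro Max_in) auto
  then obtain D where D: "orientation G D" "parcs D - F = parcs D0 - F"
    and max: "S D = Max (S ` ?C)" by auto
  have neq: "in_out_degree D u \<noteq> in_out_degree D v" if uv: "(u, v) \<in> F" "(u, v) \<in> parcs D" for u v
  proof
    assume eq: "in_out_degree D u = in_out_degree D v"
    let ?D = "reverse_arc u v D" and ?W = "pverts G - {u} - {v}"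
    have vs: "u \<in> pverts G" "v \<in> pverts G" "u \<noteq> v"
      using orientation_arc(1)[OF D(1) uv(2)] in_arcsD1 in_arcsD2 no_loops' by auto
    have split: "S E = (in_out_degree E u)\<^sup>2 + ((in_out_degree E v)\<^sup>2 +
        (\<Sum>w\<in>?W. (in_out_degree E w)\<^sup>2))" for E
      unfolding S_def using pair_finite_verts vs
      by (simp add: sum.remove[of "pverts G" u] sum.remove[of "pverts G - {u}" v])
    have "(\<Sum>w\<in>?W. (in_out_degree ?D w)\<^sup>2) = (\<Sum>w\<in>?W. (in_out_degree D w)\<^sup>2)"
      by (rule sum.cong) (auto simp: in_out_degree_reverse_arc(3)[OF D(1) uv(2)])
    then have "S ?D = S D + 8"
      unfolding split using eq
      by (simp add: in_out_degree_reverse_arc(1,2)[OF D(1) uv(2)] power2_eq_square algebra_simps)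
    moreover have "parcs ?D - F = parcs D0 - F"
      using uv(1) D(2) \<open>sym F\<close> unfolding reverse_arc_def sym_def by auto
    with orientation_reverse_arc[OF D(1) uv(2)] have "?D \<in> ?C" by simp
    with fin have "S ?D \<le> S D" unfolding max by (intro Max_ge) auto
    ultimately show False by simp
  qed
  have "in_out_degree D u \<noteq> in_out_degree D v" if "(u, v) \<in> F" for u v
  proof (cases "(u, v) \<in> parcs D")
    case False
    then have "(v, u) \<in> parcs D" using that F(2) orientation_iff[OF D(1), of u v] by blast
    then show ?thesis using neq[of v u] that F(1) by (auto simp: sym_def)
  qed (use neq that in blast)
  with D show thesis by (rule that)
qed

text \<open>All edges are taken as free. Hence the \<open>Min\<close> in the orientation number
  ranges over a nonempty set.\<close>

lemma in_out_proper_exists: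
  assumes "orientation G D0"
  shows "\<exists>D. in_out_proper G D"
proof -
  have "sym (parcs G)" using arcs_sym by (auto intro: symI)
  from assms this subset_refl obtain D where "orientation G D"
    "\<And>u v. (u, v) \<in> parcs G \<Longrightarrow> in_out_degree D u \<noteq> in_out_degree D v"
    by (rule proper_on_free_edges) (rule that)
  then show ?thesis
    by (auto simp: in_out_proper_def)
qed

section \<open>Necessity of the colouring and of the representatives\<close>

text \<open>At a vertex of degree 1 or 3 the in-out-degree is odd, so the bound 2 leaves only 1 and
  -1, and adjacent vertices must differ in sign.\<close>

lemma sign_colouring_of_orientation:
  assumes D: "in_out_proper G D" and le2: "\<And>v. v \<in> pverts G \<Longrightarrow> \<bar>in_out_degree D v\<bar> \<le> 2"
    and deg3: "\<And>v. v \<in> pverts G \<Longrightarrow> deg G v \<le> 3"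
  shows "sign_colouring G (\<lambda>v. in_out_degree D v > 0)"
proof -
  have "(in_out_degree D u > 0) \<noteq> (in_out_degree D v > 0)"
    if uv: "(u, v) \<in> parcs G" and d: "deg G u \<noteq> 2" "deg G v \<noteq> 2" for u v
  proof -
  have or: "orientation G D" using D by (simp add: in_out_proper_def)
  have vs: "u \<in> pverts G" "v \<in> pverts G" using uv in_arcsD1 in_arcsD2 by auto
  note pos = deg_pos[OF uv]
  have arith: "int a - int b \<in> {1, -1}"
    if "a + b = 1 \<or> a + b = 3" "\<bar>int a - int b\<bar> \<le> 2" for a b
    using that by simp presburger
  have "in_out_degree D u \<noteq> in_out_degree D v"
    using D uv by (auto simp: in_out_proper_def)
  moreover have "in_out_degree D w \<in> {1, -1}" if "w \<in> {u, v}" for w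
  proof -
    have "deg G w = 1 \<or> deg G w = 3" using that vs pos d deg3[of w] by force
    moreover have "\<bar>in_out_degree D w\<bar> \<le> 2" using le2[of w] that vs by blast
    ultimately show ?thesis
      using in_out_card_sum[OF or, of w] arith by (simp add: in_out_degree_card)
  qed
  ultimately show ?thesis by fastforce
  qed
  then show ?thesis by (auto simp: sign_colouring_def)
qed

text \<open>All neighbours of a core vertex have odd degree and the opposite sign, so its minority
  arc is a minority arc at the other end too. As a vertex of degree 1 has no such arc, that end has
  degree 3, and there the minority arc is unique, which makes \<open>f\<close> injective.\<close>

lemma core_representatives_of_orientation:
  assumes D: "in_out_proper G D" and le2: "\<And>v. v \<in> pverts G \<Longrightarrow> \<bar>in_out_degree D v\<bar> \<le> 2"
    and deg3: "\<And>v. v \<in> pverts G \<Longrightarrow> deg G v \<le> 3"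
  shows "\<exists>f. core_representatives G f"
proof -
  let ?d = "in_out_degree D"
  have or: "orientation G D" using D by (simp add: in_out_proper_def)
  note fin = finite_neighbours[OF or]
  text \<open>\<open>f u\<close> is the other end of the single arc at \<open>u\<close> that runs against the majority.\<close>
  define minor where "minor u w \<longleftrightarrow>
    (if ?d u > 0 then (u, w) \<in> parcs D else (w, u) \<in> parcs D)" for u w
  have unique: "\<exists>!w. minor u w" if "u \<in> pverts G" "deg G u = 3" for u
  proof -
    have "{w. minor u w} =
        (if ?d u > 0 then {w. (u, w) \<in> parcs D} else {w. (w, u) \<in> parcs D})"
      by (auto simp: minor_def)
    then have "card {w. minor u w} = 1"
      using in_out_card_sum[OF or, of u] le2[OF that(1)] that(2)
      by (auto simp: in_out_degree_card)
    then show ?thesis by (auto simp: card_1_singleton_iff set_eq_iff)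
  qed
  define f where "f u = (THE w. minor u w)" for u
  have f: "minor u (f u)" if "u \<in> core G" for u
    unfolding f_def using that by (intro theI'[OF unique]) (auto simp: core_def)
  have sign: "(?d u > 0) \<noteq> (?d v > 0)" if "u \<in> core G" "(u, v) \<in> parcs G" for u v
    using that by (intro sign_colouringD[OF sign_colouring_of_orientation[OF assms]])
      (auto simp: core_def)
  have adj: "(u, f u) \<in> parcs G" if "u \<in> core G" for u
    using f[OF that] by (auto simp: minor_def split: if_splits dest: orientation_arc(1,2)[OF or])
  \<comment> \<open>At a positive vertex the majority of arcs enters. So an arc between opposite
    signs is a minority arc at both ends or at neither.\<close>
  have conv: "minor (f u) u" if "u \<in> core G" for u
    using f[OF that] sign[OF that adj[OF that]] by (auto simp: minor_def split: if_splits)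
  have fdeg: "deg G (f u) = 3" if u: "u \<in> core G" for u
  proof -
    let ?w = "f u"
    have w: "?w \<in> pverts G" using adj[OF u] in_arcsD2 by blast
    have "deg G ?w \<noteq> 2" using adj[OF u] u by (auto simp: core_def)
    moreover have "deg G ?w \<noteq> 1"
    proof
      assume 1: "deg G ?w = 1"
      show False
      proof (cases "?d ?w > 0")
        case True
        then have "card {x. (?w, x) \<in> parcs D} \<noteq> 0"
          using conv[OF u] fin[of ?w] by (auto simp: minor_def)
        then show False
          using True in_out_card_sum[OF or, of ?w] 1 by (simp add: in_out_degree_card)
      next
        case False
        then have "card {x. (x, ?w) \<in> parcs D} \<noteq> 0"
          using conv[OF u] fin[of ?w] by (auto simp: minor_def)
        moreover have "card {x. (x, ?w) \<in> parcs D} \<le> card {x. (?w, x) \<in> parcs D}"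
          using False by (simp add: in_out_degree_card)
        ultimately show False
          using in_out_card_sum[OF or, of ?w] 1 by linarith
      qed
    qed
    moreover have "deg G ?w \<noteq> 0"
      using deg_pos(2)[OF adj[OF u]] .
    ultimately show ?thesis using deg3[OF w] by linarith
  qed
  have "inj_on f (core G)"
  proof (rule inj_onI)
    fix u v assume uv: "u \<in> core G" "v \<in> core G" "f u = f v"
    have "f u \<in> pverts G" using adj[OF uv(1)] in_arcsD2 by blast
    from unique[OF this fdeg[OF uv(1)]] show "u = v"
      using conv[OF uv(1)] conv[OF uv(2)] uv(3) by auto
  qed
  with adj fdeg show ?thesis by (auto simp: core_representatives_def)
qed

end

section \<open>Existence of orientations; a matching from representatives\<close>

lemma max_in_out_degree_le_iff:
  assumes "finite (pverts D)"
  shows "max_in_out_degree D \<le> k \<longleftrightarrow> (\<forall>v\<in>pverts D. \<bar>in_out_degree D v\<bar> \<le> int k)"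
  using assms by (auto simp: max_in_out_degree_def nat_le_iff)

text \<open>Each edge points to its end with the larger number under \<open>r\<close>; the two
  numbers differ by injectivity.\<close>

lemma (in pair_graph) orientation_exists:
  assumes "inj_on (r :: 'a \<Rightarrow> nat) (pverts G)"
  shows "\<exists>D. orientation G D"
proof
  have "r u \<noteq> r v" if "(u, v) \<in> parcs G" for u v
    using that assms in_arcsD1 in_arcsD2 no_loops' by (metis inj_on_eq_iff)
  then show "orientation G \<lparr>pverts = pverts G, parcs = {(u, v) \<in> parcs G. r u < r v}\<rparr>"
    using arcs_sym by (fastforce simp: orientation_def)
qed

text \<open>The graph of \<open>u \<mapsto> f u\<close> on \<open>U\<close> is a disjoint union of paths and cycles. A path is
  marked if it starts in a vertex of colour \<open>False\<close>; cycles are not marked.\<close>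

inductive marked :: "'a set \<Rightarrow> ('a \<Rightarrow> 'a) \<Rightarrow> ('a \<Rightarrow> bool) \<Rightarrow> 'a \<Rightarrow> bool" for U f c where
  start: "s \<in> U \<Longrightarrow> s \<notin> f ` U \<Longrightarrow> \<not> c s \<Longrightarrow> marked U f c s"
| step: "marked U f c u \<Longrightarrow> u \<in> U \<Longrightarrow> marked U f c (f u)"

lemma marked_start_iff:
  assumes "s \<in> U" "s \<notin> f ` U"
  shows "marked U f c s \<longleftrightarrow> \<not> c s"
  using assms by (auto elim: marked.cases intro: marked.start)

text \<open>By injectivity, \<open>u\<close> is the only predecessor of \<open>f u\<close>, and
  \<open>f u\<close> does not start a path.\<close>

lemma marked_step_iff:
  assumes "inj_on f U" "u \<in> U"
  shows "marked U f c (f u) \<longleftrightarrow> marked U f c u"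
proof
  assume "marked U f c (f u)"
  then show "marked U f c u"
    using assms by cases (auto dest: inj_onD)
qed (use assms in \<open>auto intro: marked.step\<close>)

text \<open>A bipartite instance of the Mendelsohn--Dulmage theorem: \<open>f\<close> pairs the vertices of
  \<open>U\<close> by using every other edge of each path and cycle, beginning with the first edge of
  every path.\<close>

lemma matching_from_representatives:
  fixes c :: "'a \<Rightarrow> bool"
  assumes inj: "inj_on f U" and col: "\<And>u. u \<in> U \<Longrightarrow> c (f u) \<noteq> c u"
  obtains M where "M \<subseteq> U" "\<And>u. u \<in> M \<Longrightarrow> f u \<notin> M" "U \<subseteq> M \<union> f ` M"
proof
  \<comment> \<open>Colours alternate along \<open>f\<close> while the mark is constant, so every
    other vertex is chosen: on a path beginning with its start, on a cycle those of colour
    \<open>True\<close>.\<close>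
  let ?M = "{u \<in> U. c u \<noteq> marked U f c u}"
  show "?M \<subseteq> U" by blast
  show "f u \<notin> ?M" if "u \<in> ?M" for u
    using that col[of u] marked_step_iff[OF inj, of u c] by auto
  show "U \<subseteq> ?M \<union> f ` ?M"
  proof
    fix u assume u: "u \<in> U"
    show "u \<in> ?M \<union> f ` ?M"
    proof (cases "u \<in> f ` U")
      case True
      then obtain v where "v \<in> U" "u = f v" by blast
      then show ?thesis using u col[of v] marked_step_iff[OF inj, of v c] by auto
    qed (use u marked_start_iff[of u U f c] in auto)
  qed
qed

section \<open>Sufficiency: an orientation from a colouring and representatives\<close>

context pair_graph
begin

text \<open>\<open>g u\<close> is the other end of the single arc at \<open>u\<close> that will run against the majority;
  a vertex without such an arc has \<open>g u = u\<close>.\<close>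

lemma minority_neighbour_exists:
  assumes c: "sign_colouring G c" and f: "core_representatives G f"
  obtains g where
    "\<And>u. u \<in> pverts G \<Longrightarrow> deg G u = 3 \<Longrightarrow> (u, g u) \<in> parcs G"
    "\<And>u. deg G u = 1 \<Longrightarrow> g u = u"
    "\<And>u v. (u, v) \<in> parcs G \<Longrightarrow> deg G u \<noteq> 2 \<Longrightarrow> deg G v \<noteq> 2 \<Longrightarrow> g u = v \<longleftrightarrow> g v = u"
proof -
  let ?U = "core G"
  have inj: "inj_on f ?U" and adj: "\<And>u. u \<in> ?U \<Longrightarrow> (u, f u) \<in> parcs G"
    and fdeg: "\<And>u. u \<in> ?U \<Longrightarrow> deg G (f u) = 3"
    using f by (auto simp: core_representatives_def)
  have Udeg: "deg G u = 3" if "u \<in> ?U" for u using that by (simp add: core_def)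
  have col: "c (f u) \<noteq> c u" if "u \<in> ?U" for u
    using sign_colouringD[OF c adj[OF that]] fdeg[OF that] Udeg[OF that] by simp
  obtain M where M: "M \<subseteq> ?U" "\<And>u. u \<in> M \<Longrightarrow> f u \<notin> M" "?U \<subseteq> M \<union> f ` M"
    by (rule matching_from_representatives[of f ?U c, OF inj]) (use col that in blast)+
  \<comment> \<open>Matched vertices point at each other. An unmatched vertex of degree 3 is outside
    the core and so has a neighbour of degree 2. The default \<open>u\<close> is never a neighbour
    of \<open>u\<close>.\<close>
  define g where "g u = (if u \<in> M then f u else if u \<in> f ` M then inv_into M f u
    else if deg G u = 3 then SOME v. (u, v) \<in> parcs G \<and> deg G v = 2 else u)" for u
  have injM: "inj_on f M" using inj M(1) by (rule inj_on_subset)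
  have g1: "g u = f u" "g (f u) = u" if "u \<in> M" for u
    using that M(2) injM by (auto simp: g_def)
  have g2: "(u, g u) \<in> parcs G \<and> deg G (g u) = 2"
    if "u \<in> pverts G" "deg G u = 3" "u \<notin> M" "u \<notin> f ` M" for u
  proof -
    have "u \<notin> ?U" using that M(3) by blast
    then have "\<exists>v. (u, v) \<in> parcs G \<and> deg G v = 2" using that by (auto simp: core_def)
    from someI_ex[OF this] show ?thesis using that by (simp add: g_def)
  qed
  have sym: "g v = u"
    if "(u, v) \<in> parcs G" "deg G u \<noteq> 2" "deg G v \<noteq> 2" "g u = v" for u v
  proof -
    have u: "u \<in> pverts G" "u \<noteq> v" using that in_arcsD1 no_loops' by blast+
    consider "u \<in> M" | "u \<in> f ` M" | "u \<notin> M" "u \<notin> f ` M" by blast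
    then show ?thesis
    proof cases
      case 3
      then have "deg G u = 3" using that(4) u(2) by (auto simp: g_def split: if_splits)
      from g2[OF u(1) this 3] show ?thesis using that by simp
    qed (use that(4) g1 in auto)
  qed
  show thesis
  proof
    show "(u, g u) \<in> parcs G" if "u \<in> pverts G" "deg G u = 3" for u
    proof -
      consider "u \<in> M" | "u \<in> f ` M" | "u \<notin> M" "u \<notin> f ` M" by blast
      then show ?thesis
      proof cases
        case 2
        then obtain v where "v \<in> M" "u = f v" by blast
        then show ?thesis using g1(2) adj[of v] M(1) arcs_sym[of v "f v"] by auto
      qed (use g1 adj M(1) g2[OF that] in auto)
    qed
    show "g u = u" if "deg G u = 1" for u
    proof -
      have "u \<notin> M" "u \<notin> f ` M" using that Udeg fdeg M(1) by fastforce+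
      then show ?thesis using that by (simp add: g_def)
    qed
    show "g u = v \<longleftrightarrow> g v = u"
      if "(u, v) \<in> parcs G" "deg G u \<noteq> 2" "deg G v \<noteq> 2" for u v
      using sym[of u v] sym[of v u] that arcs_sym[of u v] by blast
  qed
qed

text \<open>Colours and minority arcs prescribe all arcs at vertices of degree 1 and 3 and give the
  values 1 and -1 there. Edges between vertices of degree 2 stay free, and an edge between degree 2
  and odd degree is proper by parity.\<close>

lemma orientation_of_colouring_and_representatives:
  assumes c: "sign_colouring G c" and f: "core_representatives G f"
    and deg3: "\<And>v. v \<in> pverts G \<Longrightarrow> deg G v \<le> 3" and D1: "orientation G D1"
  shows "\<exists>D. in_out_proper G D \<and> (\<forall>v\<in>pverts G. \<bar>in_out_degree D v\<bar> \<le> 2)"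
proof -
  obtain g where
    g3: "\<And>u. u \<in> pverts G \<Longrightarrow> deg G u = 3 \<Longrightarrow> (u, g u) \<in> parcs G" and
    g1: "\<And>u. deg G u = 1 \<Longrightarrow> g u = u" and
    gsym: "\<And>u v. (u, v) \<in> parcs G \<Longrightarrow> deg G u \<noteq> 2 \<Longrightarrow> deg G v \<noteq> 2 \<Longrightarrow> g u = v \<longleftrightarrow> g v = u"
    using c f by (rule minority_neighbour_exists) (rule that)
  \<comment> \<open>Colour \<open>True\<close> stands for the value 1: all arcs enter except the one
    to \<open>g u\<close>. For \<open>False\<close> it is the reverse. \<open>D1\<close> is a
    preliminary choice on the free edges.\<close>
  define out where "out u v \<longleftrightarrow> (if deg G u \<noteq> 2 then c u = (g u = v)
    else if deg G v \<noteq> 2 then c v \<noteq> (g v = u) else (u, v) \<in> parcs D1)" for u v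
  define D0 where "D0 = \<lparr>pverts = pverts G, parcs = {(u, v) \<in> parcs G. out u v}\<rparr>"
  have out_flip: "out u v \<longleftrightarrow> \<not> out v u" if uv: "(u, v) \<in> parcs G" for u v
  proof (cases "deg G u = 2 \<or> deg G v = 2")
    case True
    then show ?thesis
      using orientation_iff[OF D1 uv] unfolding out_def
      by (cases "deg G u = 2"; cases "deg G v = 2") simp_all
  next
    case False
    then have "g u = v \<longleftrightarrow> g v = u" "c u \<noteq> c v"
      "out u v \<longleftrightarrow> c u = (g u = v)" "out v u \<longleftrightarrow> c v = (g v = u)"
      using gsym[OF uv] sign_colouringD[OF c uv] by (auto simp: out_def)
    then show ?thesis by blast
  qed
  have "(u, v) \<in> parcs D0 \<longleftrightarrow> (v, u) \<notin> parcs D0" if "(u, v) \<in> parcs G" for u v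
    using that arcs_sym[of u v] out_flip[OF that] by (simp add: D0_def)
  then have D0: "orientation G D0"
    unfolding orientation_def by (auto simp: D0_def)
  define F where "F = {(u, v) \<in> parcs G. deg G u = 2 \<and> deg G v = 2}"
  have F: "sym F" "F \<subseteq> parcs G" using arcs_sym by (auto simp: F_def sym_def)
  obtain D where D: "orientation G D" "parcs D - F = parcs D0 - F"
    and neq: "\<And>u v. (u, v) \<in> F \<Longrightarrow> in_out_degree D u \<noteq> in_out_degree D v"
    using D0 F by (rule proper_on_free_edges) (rule that)
  have D_out: "(u, v) \<in> parcs D \<longleftrightarrow> (u, v) \<in> parcs G \<and> out u v" if "deg G u \<noteq> 2 \<or> deg G v \<noteq> 2" for u v
  proof -
    have "(u, v) \<notin> F" using that by (auto simp: F_def)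
    then have "(u, v) \<in> parcs D \<longleftrightarrow> (u, v) \<in> parcs D0" using D(2) by blast
    then show ?thesis by (simp add: D0_def)
  qed
  have val: "in_out_degree D u = (if c u then 1 else -1)"
    if u: "u \<in> pverts G" "deg G u \<noteq> 2" "deg G u \<noteq> 0" for u
  proof -
    let ?N = "{v. (u, v) \<in> parcs G}" and ?O = "{v. (u, v) \<in> parcs D}"
    have N: "card ?N = deg G u" by (simp add: deg_def)
    have O: "?O = (if c u then ?N \<inter> {g u} else ?N - {g u})"
      using D_out u(2) by (auto simp: out_def)
    consider "deg G u = 1" | "deg G u = 3" using u deg3[OF u(1)] by linarith
    then have "int (card ?O) = (if c u then (int (deg G u) - 1) div 2 else (int (deg G u) + 1) div 2)"
    proof cases
      case 1
      then have "g u \<notin> ?N" using g1 no_loops' by auto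
      then have "?O = (if c u then {} else ?N)" using O by auto
      then show ?thesis using 1 N by simp
    next
      case 2
      then have "g u \<in> ?N" using g3 u by auto
      then have "?O = (if c u then {g u} else ?N - {g u})" using O by auto
      then show ?thesis using 2 N finite_out_neighbours[of u] \<open>g u \<in> ?N\<close> by simp
    qed
    moreover have "deg G u = 1 \<or> deg G u = 3" using u deg3[OF u(1)] by linarith
    ultimately show ?thesis
      using in_out_card_sum[OF D(1), of u] unfolding in_out_degree_card
      by (elim disjE; cases "c u") simp_all
  qed
  have bound: "\<bar>in_out_degree D u\<bar> \<le> 2" if "u \<in> pverts G" for u
  proof (cases "deg G u = 2 \<or> deg G u = 0")
    case True
    then show ?thesis
      using in_out_card_sum[OF D(1), of u] by (auto simp: in_out_degree_card)
  qed (use val that in auto)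
  have even_odd: "even (in_out_degree D u) \<longleftrightarrow> even (deg G u)" for u
    using in_out_card_sum[OF D(1), of u, symmetric] by (simp add: in_out_degree_card)
  have "in_out_degree D u \<noteq> in_out_degree D v" if uv: "(u, v) \<in> parcs G" for u v
  proof (cases "deg G u = 2 \<longleftrightarrow> deg G v = 2")
    case True
    have vs: "u \<in> pverts G" "v \<in> pverts G" using uv in_arcsD1 in_arcsD2 by blast+
    show ?thesis
    proof (cases "deg G u = 2")
      case True
      with \<open>deg G u = 2 \<longleftrightarrow> deg G v = 2\<close> uv show ?thesis by (auto simp: F_def intro!: neq)
    next
      case False
      with True have "c u \<noteq> c v" using sign_colouringD[OF c uv] by blast
      then show ?thesis
        using val[OF vs(1)] val[OF vs(2)] deg_pos[OF uv] False True by auto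
    qed
  next
    case False
    have vs: "u \<in> pverts G" "v \<in> pverts G" using uv in_arcsD1 in_arcsD2 by blast+
    have "odd (deg G w)" if "w \<in> {u, v}" "deg G w \<noteq> 2" for w
    proof -
      have "deg G w = 1 \<or> deg G w = 3"
        using that deg_pos[OF uv] deg3[of w] vs by force
      then show ?thesis by auto
    qed
    with False have "even (deg G u) \<noteq> even (deg G v)" by auto
    then show ?thesis using even_odd by metis
  qed
  with D(1) bound show ?thesis by (auto simp: in_out_proper_def)
qed

end

text \<open>The minimum over a finite nonempty set is attained. The conditions on \<open>c\<close>
  and \<open>f\<close> are separate, so each can be tested on its own.\<close>

theorem (in pair_graph) orientation_number_le_2_iff:
  assumes deg3: "max_degree G = 3"
  shows "in_out_proper_orientation_number G \<le> 2 \<longleftrightarrow>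
    (\<exists>c. sign_colouring G c) \<and> (\<exists>f. core_representatives G f)"
proof -
  let ?P = "{D. in_out_proper G D}"
  have deg3: "deg G v \<le> 3" if "v \<in> pverts G" for v
  proof -
    have "out_degree (with_proj G) v \<le> max_degree G"
      unfolding max_degree_def using that pair_finite_verts by (intro Max_ge) auto
    then show ?thesis using deg3 by (simp add: deg_def out_degree_with_proj)
  qed
  obtain r :: "'a \<Rightarrow> nat" where "inj_on r (pverts G)"
    using finite_imp_inj_to_nat_seg[OF pair_finite_verts] by blast
  then obtain D1 where D1: "orientation G D1"
    using orientation_exists by blast
  have "?P \<noteq> {}" using in_out_proper_exists[OF D1] by blast
  moreover have "finite ?P"
    using finite_orientations by (rule rev_finite_subset) (auto simp: in_out_proper_def)
  ultimately have "in_out_proper_orientation_number G \<le> 2 \<longleftrightarrow>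
      (\<exists>D. in_out_proper G D \<and> max_in_out_degree D \<le> 2)"
    unfolding in_out_proper_orientation_number_def by (subst Min_le_iff) auto
  also have "\<dots> \<longleftrightarrow> (\<exists>D. in_out_proper G D \<and> (\<forall>v\<in>pverts G. \<bar>in_out_degree D v\<bar> \<le> 2))"
  proof -
    have "max_in_out_degree D \<le> 2 \<longleftrightarrow> (\<forall>v\<in>pverts G. \<bar>in_out_degree D v\<bar> \<le> 2)"
      if "in_out_proper G D" for D
    proof -
      have "pverts D = pverts G" using that by (simp add: in_out_proper_def orientation_def)
      then show ?thesis using max_in_out_degree_le_iff[of D 2] pair_finite_verts by simp
    qed
    then show ?thesis by blast
  qed
  also have "\<dots> \<longleftrightarrow> (\<exists>c. sign_colouring G c) \<and> (\<exists>f. core_representatives G f)"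
    using sign_colouring_of_orientation core_representatives_of_orientation
      orientation_of_colouring_and_representatives[OF _ _ deg3 D1] deg3 by metis
  finally show ?thesis .
qed

section \<open>Merging components with a 2-colouring\<close>

definition proper_colouring :: "(nat \<times> nat) set \<Rightarrow> (nat \<Rightarrow> bool) \<Rightarrow> bool" where
  "proper_colouring F c \<longleftrightarrow> (\<forall>(u, v) \<in> F. c u \<noteq> c v)"

text \<open>\<open>K\<close> names the component of a vertex and \<open>L\<close> its colour, in the graph with the
  edges \<open>F\<close> on \<open>{..<n}\<close>. The third condition says that every proper colouring agrees with
  \<open>L\<close> on each component, up to exchanging the colours.\<close>

definition parity_structure ::
    "nat \<Rightarrow> (nat \<times> nat) set \<Rightarrow> (nat \<Rightarrow> nat) \<Rightarrow> (nat \<Rightarrow> nat) \<Rightarrow> bool" where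
  "parity_structure n F K L \<longleftrightarrow>
     (\<forall>x<n. L x \<in> {0, 1}) \<and>
     (\<forall>(u, v) \<in> F. K u = K v \<and> L u \<noteq> L v) \<and>
     (\<forall>c. proper_colouring F c \<longrightarrow>
       (\<forall>x<n. \<forall>y<n. K x = K y \<longrightarrow> (c x = c y \<longleftrightarrow> L x = L y)))"

lemma parity_structure_empty:
  assumes "\<And>x. x < n \<Longrightarrow> K x = x" "\<And>x. x < n \<Longrightarrow> L x = 0"
  shows "parity_structure n {} K L"
  using assms by (auto simp: parity_structure_def)

lemma parity_structure_imp_proper_colouring:
  assumes "parity_structure n F K L" "F \<subseteq> {..<n} \<times> {..<n}"
  shows "proper_colouring F (\<lambda>x. L x = 1)"
proof -
  have "(L u = 1) \<noteq> (L v = 1)" if "(u, v) \<in> F" for u v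
  proof -
    have "u < n" "v < n" "L u \<noteq> L v"
      using that assms by (auto simp: parity_structure_def)
    moreover from this have "L u \<in> {0, 1}" "L v \<in> {0, 1}"
      using assms(1) unfolding parity_structure_def by blast+
    ultimately show ?thesis by auto
  qed
  then show ?thesis by (auto simp: proper_colouring_def)
qed

text \<open>Every proper colouring of \<open>F\<close> gives vertices of one component with equal
  labels the same colour, which the new edge forbids. \<open>A\<close> stands for the whole edge
  set, \<open>F\<close> for the part treated so far.\<close>

lemma parity_structure_conflict:
  assumes "parity_structure n F K L" "u < n" "v < n" "K u = K v" "L u = L v"
    and "insert (u, v) F \<subseteq> A"
  shows "\<not> proper_colouring A c"
proof
  assume "proper_colouring A c"
  then have "proper_colouring F c" "c u \<noteq> c v"
    using assms(6) by (auto simp: proper_colouring_def)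
  then show False using assms(1-5) unfolding parity_structure_def by blast
qed

lemma parity_structure_insert_same:
  assumes "parity_structure n F K L" "K u = K v" "L u \<noteq> L v"
  shows "parity_structure n (insert (u, v) F) K L"
  using assms by (simp add: parity_structure_def proper_colouring_def)

text \<open>As \<open>r\<close> and \<open>t\<close> differ, \<open>p = q\<close> holds iff exactly
  one of \<open>p = r\<close> and \<open>q = t\<close> does. Below, \<open>p\<close>,
  \<open>q\<close>, \<open>r\<close>, \<open>t\<close> are the colours of \<open>x\<close>,
  \<open>y\<close>, \<open>u\<close>, \<open>v\<close>, and \<open>a\<close>, \<open>b\<close>,
  \<open>d\<close>, \<open>e\<close> are their labels.\<close>

lemma parity_flip:
  fixes a b d e :: nat and p q r t :: bool
  assumes "a = 0 \<or> a = 1" "b = 0 \<or> b = 1" "d = 0 \<or> d = 1" "e = 0 \<or> e = 1"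
    and "r \<noteq> t" "p = r \<longleftrightarrow> a = d" "q = t \<longleftrightarrow> b = e"
  shows "p = q \<longleftrightarrow> (if d = e then 1 - a else a) = b"
proof -
  have "p = q \<longleftrightarrow> (p = r) \<noteq> (q = t)" using assms(5) by blast
  then have "p = q \<longleftrightarrow> (a = d) \<noteq> (b = e)" unfolding assms(6,7) .
  moreover have "(a = d) \<noteq> (b = e) \<longleftrightarrow> (if d = e then 1 - a else a) = b"
    using assms(1-4) by auto
  ultimately show ?thesis by (rule trans)
qed

text \<open>The new edge fixes how the colours on the two old components are related. The labels
  around \<open>u\<close> are flipped exactly if the edge would otherwise have equal labels at its
  ends.\<close>

lemma parity_structure_insert_merge:
  assumes ps: "parity_structure n F K L" and F: "F \<subseteq> {..<n} \<times> {..<n}"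
    and uv: "u < n" "v < n" "K u \<noteq> K v"
    and K': "\<And>x. x < n \<Longrightarrow> K' x = (if K x = K u then K v else K x)"
    and L': "\<And>x. x < n \<Longrightarrow> L' x = (if K x = K u \<and> L u = L v then 1 - L x else L x)"
  shows "parity_structure n (insert (u, v) F) K' L'"
proof -
  have bit: "L x = 0 \<or> L x = 1" if "x < n" for x
    using ps that by (auto simp: parity_structure_def)
  have old: "K' x = K' y \<and> L' x \<noteq> L' y" if xy: "(x, y) \<in> F" for x y
  proof -
    have "x < n" "y < n" "K x = K y" "L x \<noteq> L y"
      using xy F ps by (auto simp: parity_structure_def)
    then show ?thesis using bit[of x] bit[of y] K' L' by auto
  qed
  have new: "K' u = K' v \<and> L' u \<noteq> L' v"
    using uv bit[of u] bit[of v] by (auto simp: K' L')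
  have col: "c x = c y \<longleftrightarrow> L' x = L' y"
    if c: "proper_colouring (insert (u, v) F) c" and x: "x < n" and y: "y < n" and "K' x = K' y"
    for c x y
  proof -
    have cuv: "c u \<noteq> c v" and "proper_colouring F c"
      using c by (auto simp: proper_colouring_def)
    then have *: "c a = c b \<longleftrightarrow> L a = L b" if "a < n" "b < n" "K a = K b" for a b
      using ps that by (auto simp: parity_structure_def)
    note bits = bit[OF x] bit[OF y] bit[OF uv(1)] bit[OF uv(2)]
    consider "K x = K y" | "K x = K u" "K y = K v" | "K x = K v" "K y = K u"
      using \<open>K' x = K' y\<close> K'[OF x] K'[OF y] by (auto split: if_splits)
    then show ?thesis
    proof cases
      case 1
      then show ?thesis using *[OF x y] bits L'[OF x] L'[OF y] by auto
    next
      case 2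
      have "c x = c y \<longleftrightarrow> (if L u = L v then 1 - L x else L x) = L y"
        using bits(1,2,3,4) cuv *[OF x uv(1) 2(1)] *[OF y uv(2) 2(2)] by (rule parity_flip)
      moreover have "L' x = (if L u = L v then 1 - L x else L x)" "L' y = L y"
        using 2 uv(3) L'[OF x] L'[OF y] by auto
      ultimately show ?thesis by (metis (full_types))
    next
      case 3
      have "c y = c x \<longleftrightarrow> (if L u = L v then 1 - L y else L y) = L x"
        using bits(2,1,3,4) cuv *[OF y uv(1) 3(2)] *[OF x uv(2) 3(1)] by (rule parity_flip)
      moreover have "L' y = (if L u = L v then 1 - L y else L y)" "L' x = L x"
        using 3 uv(3) L'[OF x] L'[OF y] by auto
      ultimately show ?thesis by (metis (full_types))
    qed
  qed
  have "\<forall>x<n. L' x \<in> {0, 1}" using bit L' by auto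
  with old new col show ?thesis unfolding parity_structure_def by blast
qed

section \<open>Auctions\<close>

text \<open>The bidders \<open>U \<subseteq> {..<n}\<close> compete for objects in \<open>{..<n}\<close>, and \<open>R u v\<close> means that
  bidder \<open>u\<close> accepts object \<open>v\<close>. Stored indices are shifted by one: \<open>own v = Suc u\<close> and
  \<open>mate (Suc u) = Suc v\<close> mean that \<open>u\<close> holds \<open>v\<close>, and the value 0 means unassigned. By the
  last condition, no bidder would pay much less for another object.\<close>

definition auction_inv :: "nat \<Rightarrow> nat set \<Rightarrow> (nat \<Rightarrow> nat \<Rightarrow> bool) \<Rightarrow>
    (nat \<Rightarrow> nat) \<Rightarrow> (nat \<Rightarrow> nat) \<Rightarrow> (nat \<Rightarrow> nat) \<Rightarrow> bool" where
  "auction_inv n U R own mate price \<longleftrightarrow>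
     (\<forall>v<n. \<forall>u. own v = Suc u \<longrightarrow> u \<in> U \<and> R u v \<and> mate (Suc u) = Suc v) \<and>
     (\<forall>u v. u \<in> U \<longrightarrow> mate (Suc u) = Suc v \<longrightarrow> v < n \<and> own v = Suc u) \<and>
     (\<forall>v<n. own v = 0 \<longrightarrow> price v = 0) \<and>
     (\<forall>v<n. \<forall>u w. own v = Suc u \<longrightarrow> R u w \<longrightarrow> price v \<le> Suc (price w))"

lemma auction_invD:
  assumes "auction_inv n U R own mate price"
  shows "v < n \<Longrightarrow> own v = Suc u \<Longrightarrow> u \<in> U \<and> R u v \<and> mate (Suc u) = Suc v"
    and "u \<in> U \<Longrightarrow> mate (Suc u) = Suc v \<Longrightarrow> v < n \<and> own v = Suc u"
    and "v < n \<Longrightarrow> own v = 0 \<Longrightarrow> price v = 0"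
    and "v < n \<Longrightarrow> own v = Suc u \<Longrightarrow> R u w \<Longrightarrow> price v \<le> Suc (price w)"
  using assms unfolding auction_inv_def by blast+

definition assignment :: "nat set \<Rightarrow> (nat \<Rightarrow> nat \<Rightarrow> bool) \<Rightarrow> (nat \<Rightarrow> nat) \<Rightarrow> bool" where
  "assignment U R f \<longleftrightarrow> inj_on f U \<and> (\<forall>u\<in>U. R u (f u))"

locale auction =
  fixes n :: nat and U :: "nat set" and R :: "nat \<Rightarrow> nat \<Rightarrow> bool"
  assumes U_less: "u \<in> U \<Longrightarrow> u < n" and R_less: "R u v \<Longrightarrow> v < n"
begin

lemma assignment_of_mates:
  assumes inv: "auction_inv n U R own mate price" and all: "\<forall>u\<in>U. mate (Suc u) \<noteq> 0"
  shows "\<exists>f. assignment U R f"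
proof -
  let ?f = "\<lambda>u. mate (Suc u) - 1"
  have f: "own (?f u) = Suc u" "?f u < n" if "u \<in> U" for u
  proof -
    obtain v where "mate (Suc u) = Suc v" using all \<open>u \<in> U\<close> not0_implies_Suc by blast
    then show "own (?f u) = Suc u" "?f u < n"
      using auction_invD(2)[OF inv \<open>u \<in> U\<close>] by auto
  qed
  have "inj_on ?f U" by (rule inj_onI) (metis f(1) nat.inject)
  moreover have "R u (?f u)" if "u \<in> U" for u
    using auction_invD(1)[OF inv f(2,1)[OF that]] by blast
  ultimately show ?thesis by (auto simp: assignment_def)
qed

lemma owners:
  assumes inv: "auction_inv n U R own mate price" and S: "S \<subseteq> {..<n}" "\<And>v. v \<in> S \<Longrightarrow> own v \<noteq> 0"
  shows "inj_on (\<lambda>v. own v - 1) S"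
    and "v \<in> S \<Longrightarrow> own v - 1 \<in> U \<and> mate (Suc (own v - 1)) = Suc v"
proof -
  have *: "own v - 1 \<in> U \<and> mate (Suc (own v - 1)) = Suc v" if v: "v \<in> S" for v
  proof -
    obtain u where u: "own v = Suc u" using S(2)[OF v] not0_implies_Suc by blast
    have "v < n" using S(1) v by blast
    from auction_invD(1)[OF inv this u] u show ?thesis by simp
  qed
  then show "v \<in> S \<Longrightarrow> own v - 1 \<in> U \<and> mate (Suc (own v - 1)) = Suc v" .
  show "inj_on (\<lambda>v. own v - 1) S"
    by (rule inj_onI) (metis * nat.inject)
qed

text \<open>If all \<open>n\<close> objects were held, they would have \<open>n\<close> distinct
  owners among the fewer than \<open>n\<close> bidders other than \<open>u\<close>.\<close>

lemma unowned_exists: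
  assumes inv: "auction_inv n U R own mate price" and u: "u \<in> U" "mate (Suc u) = 0"
  shows "\<exists>v<n. own v = 0"
proof (rule ccontr)
  assume "\<not> ?thesis"
  then have own: "own v \<noteq> 0" if "v \<in> {..<n}" for v using that by auto
  note ow = owners[OF inv subset_refl own]
  have "(\<lambda>v. own v - 1) ` {..<n} \<subseteq> {..<n} - {u}"
    using ow(2) U_less u(2) by fastforce
  from card_mono[OF _ this] have "n \<le> n - 1"
    using ow(1) U_less[OF u(1)] by (simp add: card_image)
  then show False using U_less[OF u(1)] by simp
qed

text \<open>If the price of \<open>f u\<close> were \<open>n\<close> or more, some value below it would not occur as a price.
  The bidders holding an object that is more expensive than this gap, together with \<open>u\<close>, then
  accept no cheaper objects, so there are fewer of those objects than such bidders.\<close>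

lemma price_less:
  assumes inv: "auction_inv n U R own mate price" and f: "assignment U R f"
    and u: "u \<in> U" "mate (Suc u) = 0"
  shows "price (f u) < n"
proof (rule ccontr)
  assume "\<not> ?thesis"
  then have ge: "n \<le> price (f u)" by simp
  have Rf: "R w (f w)" if "w \<in> U" for w using f that by (simp add: assignment_def)
  have fu: "f u < n" using Rf[OF u(1)] R_less by blast
  \<comment> \<open>The \<open>n - 1\<close> objects other than \<open>f u\<close> cannot realise
    all \<open>n\<close> values below \<open>n\<close>.\<close>
  have "\<not> {..<n} \<subseteq> price ` ({..<n} - {f u})"
  proof
    assume "{..<n} \<subseteq> price ` ({..<n} - {f u})"
    from card_mono[OF _ this] have "n \<le> card (price ` ({..<n} - {f u}))" by simp
    also have "\<dots> \<le> card ({..<n} - {f u})" by (rule card_image_le) simp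
    also have "\<dots> < n" using fu by simp
    finally show False by simp
  qed
  then obtain j where j: "j < n" "j \<notin> price ` ({..<n} - {f u})" by blast
  then have gap: "price v \<noteq> j" if "v < n" for v
    using that ge by (cases "v = f u") auto
  let ?S = "{v. v < n \<and> j < price v}"
  have own: "own v \<noteq> 0" if "v \<in> ?S" for v
    using that auction_invD(3)[OF inv] by fastforce
  have "?S \<subseteq> {..<n}" by auto
  note ow = owners[OF inv this own]
  let ?T = "insert u ((\<lambda>v. own v - 1) ` ?S)"
  have TU: "?T \<subseteq> U" using ow(2) u(1) by auto
  have "f w \<in> ?S" if w: "w \<in> ?T" for w
  proof (cases "w = u")
    case True
    then show ?thesis using fu ge j(1) by simp
  next
    case False
    then obtain v where v: "v \<in> ?S" "w = own v - 1" using w by blast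
    then have "own v = Suc w" using own by fastforce
    moreover have "R w (f w)" using Rf TU w by blast
    ultimately have "price v \<le> Suc (price (f w))"
      using auction_invD(4)[OF inv] v(1) by blast
    \<comment> \<open>From \<open>j < price v\<close> it follows that \<open>price (f w)\<close> is
      at least \<open>j\<close>, and the gap excludes equality.\<close>
    then show ?thesis
      using v(1) gap[of "f w"] R_less[OF \<open>R w (f w)\<close>] by simp
  qed
  then have "f ` ?T \<subseteq> ?S" by blast
  from card_mono[OF _ this] have "card (f ` ?T) \<le> card ?S" by simp
  moreover have "inj_on f ?T"
    by (rule inj_on_subset[OF _ TU]) (use f in \<open>simp add: assignment_def\<close>)
  then have "card (f ` ?T) = card ?T" by (rule card_image)
  moreover have "own v - 1 \<noteq> u" if "v \<in> ?S" for v
    using ow(2)[of v] that u(2) by auto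
  then have "u \<notin> (\<lambda>v. own v - 1) ` ?S" by blast
  then have "card ?T = Suc (card ?S)"
    using ow(1) by (simp add: card_image)
  ultimately show False by simp
qed

text \<open>As \<open>v\<close> is cheapest for \<open>u\<close>, raising its price by 1 respects
  the last condition; for other bidders a higher price elsewhere only relaxes it. If
  \<open>v\<close> had no owner, the reset of \<open>mate\<close> hits index 0, which belongs to no
  bidder.\<close>

lemma auction_inv_bid:
  assumes inv: "auction_inv n U R own mate price"
    and u: "u \<in> U" "mate (Suc u) = 0"
    and v: "R u v" "\<And>w. R u w \<Longrightarrow> price v \<le> price w"
  shows "auction_inv n U R (own(v := Suc u)) (mate(own v := 0, Suc u := Suc v))
    (price(v := Suc (price v)))"
proof -
  have vn: "v < n" using v(1) R_less by blast
  have 1: "x \<in> U" "R x w" "mate (Suc x) = Suc w" if "w < n" "own w = Suc x" for x w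
    using auction_invD(1)[OF inv] that by blast+
  have 2: "w < n" "own w = Suc x" if "x \<in> U" "mate (Suc x) = Suc w" for x w
    using auction_invD(2)[OF inv] that by blast+
  have 3: "price w = 0" if "w < n" "own w = 0" for w
    using auction_invD(3)[OF inv] that by blast+
  have 4: "price w \<le> Suc (price y)" if "w < n" "own w = Suc x" "R x y" for w x y
    using auction_invD(4)[OF inv] that by blast+
  let ?own = "own(v := Suc u)" and ?mate = "mate(own v := 0, Suc u := Suc v)"
    and ?price = "price(v := Suc (price v))"
  have "x \<in> U \<and> R x w \<and> ?mate (Suc x) = Suc w" if w: "w < n" "?own w = Suc x" for x w
  proof (cases "w = v")
    case False
    then have "own w = Suc x" using w by simp
    note x = 1[OF w(1) this]
    have "Suc x \<noteq> own v" using 1(3)[OF vn, of x] x(3) False by auto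
    moreover have "x \<noteq> u" using x(3) u(2) by auto
    ultimately show ?thesis using x by simp
  qed (use w u v in auto)
  moreover have "w < n \<and> ?own w = Suc x" if x: "x \<in> U" "?mate (Suc x) = Suc w" for x w
  proof (cases "x = u")
    case False
    then have "mate (Suc x) = Suc w" "Suc x \<noteq> own v" using x by (auto split: if_splits)
    with 2[OF x(1)] show ?thesis by auto
  qed (use x vn in auto)
  moreover have "?price w = 0" if "w < n" "?own w = 0" for w
    using that 3 by (auto split: if_splits)
  moreover have "?price w \<le> Suc (?price y)" if w: "w < n" "?own w = Suc x" "R x y" for w x y
  proof (cases "w = v")
    case True
    then show ?thesis using v(2)[of y] w by auto
  next
    case False
    then show ?thesis using 4[of w x y] w by (auto split: if_splits)
  qed
  ultimately show ?thesis unfolding auction_inv_def by blast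
qed

text \<open>Some object is unowned and costs 0, and the other \<open>n - 1\<close> cost at most
  \<open>n\<close> each. Since every bid adds 1 to the sum, this limits the number of bids.\<close>

lemma sum_price_less:
  assumes inv: "auction_inv n U R own mate price" and u: "u \<in> U" "mate (Suc u) = 0"
    and le: "\<And>v. v < n \<Longrightarrow> price v \<le> n"
  shows "(\<Sum>v<n. price v) < n * n"
proof -
  obtain v where v: "v < n" "own v = 0" using unowned_exists[OF inv u] by blast
  then have "price v = 0" using auction_invD(3)[OF inv] by blast
  moreover have "(\<Sum>w<n. price w) = price v + (\<Sum>w\<in>{..<n} - {v}. price w)"
    using v(1) by (intro sum.remove) auto
  moreover have "(\<Sum>w\<in>{..<n} - {v}. price w) \<le> (n - 1) * n"
    using sum_bounded_above[of "{..<n} - {v}" price n] le v(1) by simp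
  moreover have "(n - 1) * n < n * n" using v(1) by simp
  ultimately show ?thesis by linarith
qed

end

section \<open>Running times of programs with bounded loops\<close>

text \<open>An upper bound for the running time of a program whose loops make at most \<open>m\<close>
  iterations each.\<close>

primrec cost :: "nat \<Rightarrow> com \<Rightarrow> nat" where
  "cost m Skip = 1"
| "cost m (Assign x a b) = 1"
| "cost m (Seq c d) = cost m c + cost m d"
| "cost m (If b c d) = Suc (cost m c + cost m d)"
| "cost m (While b c) = m * Suc (cost m c) + 1"

text \<open>Each level of loop nesting contributes a factor \<open>m\<close>, and the nesting depth
  is fixed by the program.\<close>

lemma cost_poly: "\<exists>p. \<forall>m. cost m c = poly p m"
proof (induction c)
  case (Seq c d)
  then obtain p q where "\<forall>m. cost m c = poly p m" "\<forall>m. cost m d = poly q m" by blast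
  then show ?case by (intro exI[of _ "p + q"]) simp
next
  case (If b c d)
  then obtain p q where "\<forall>m. cost m c = poly p m" "\<forall>m. cost m d = poly q m" by blast
  then show ?case by (intro exI[of _ "1 + (p + q)"]) simp
next
  case (While b c)
  then obtain p where "\<forall>m. cost m c = poly p m" by blast
  then show ?case by (intro exI[of _ "[:0, 1:] * (1 + p) + 1"]) simp
qed (auto intro!: exI[of _ 1])

text \<open>Total correctness with a time bound. As \<open>cost\<close> depends on the program and
  \<open>m\<close> only, it remains to bound the iterations of each loop by
  \<open>m\<close>.\<close>

definition runs :: "nat \<Rightarrow> com \<Rightarrow> state \<Rightarrow> (state \<Rightarrow> bool) \<Rightarrow> bool" where
  "runs m c s Q \<longleftrightarrow> (\<exists>t s'. exec c s t s' \<and> t \<le> cost m c \<and> Q s')"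

lemma runs_mono: "runs m c s Q \<Longrightarrow> (\<And>s'. Q s' \<Longrightarrow> Q' s') \<Longrightarrow> runs m c s Q'"
  unfolding runs_def by blast

lemma runs_Skip: "Q s \<Longrightarrow> runs m Skip s Q"
  unfolding runs_def by (force intro: exec.Skip)

lemma runs_Assign: "Q (s(x := (s x)(aval a s := aval b s))) \<Longrightarrow> runs m (Assign x a b) s Q"
  unfolding runs_def by (force intro: exec.Assign)

lemma runs_Seq: "runs m c s (\<lambda>s'. runs m d s' Q) \<Longrightarrow> runs m (Seq c d) s Q"
  unfolding runs_def by (force intro: exec.Seq add_mono)

lemma runs_then:
  "runs m c s P \<Longrightarrow> (\<And>s. P s \<Longrightarrow> runs m d s Q) \<Longrightarrow> runs m (Seq c d) s Q"
  by (blast intro: runs_Seq runs_mono)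

lemma runs_If:
  assumes "bval b s \<Longrightarrow> runs m c s Q" "\<not> bval b s \<Longrightarrow> runs m d s Q"
  shows "runs m (If b c d) s Q"
proof (cases "bval b s")
  case True
  with assms(1) obtain t s' where "exec c s t s'" "t \<le> cost m c" "Q s'" by (auto simp: runs_def)
  then show ?thesis unfolding runs_def
    using exec.IfTrue[OF True] by (intro exI[of _ "Suc t"] exI[of _ s']) auto
next
  case False
  with assms(2) obtain t s' where "exec d s t s'" "t \<le> cost m d" "Q s'" by (auto simp: runs_def)
  then show ?thesis unfolding runs_def
    using exec.IfFalse[OF False] by (intro exI[of _ "Suc t"] exI[of _ s']) auto
qed

abbreviation V :: "vname \<Rightarrow> aexp" where
  "V x \<equiv> Rd x (N 0)"

abbreviation Set :: "vname \<Rightarrow> aexp \<Rightarrow> com" where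
  "Set x \<equiv> Assign x (N 0)"

definition For :: "vname \<Rightarrow> aexp \<Rightarrow> com \<Rightarrow> com" where
  "For i e c = Seq (Set i (N 0))
     (While (Less (V i) e) (Seq c (Set i (Plus (V i) (N 1)))))"

text \<open>Induction on the remaining iterations \<open>b - k\<close>. The invariant pins the
  counter to \<open>k\<close> and the value of \<open>e\<close> to \<open>b\<close>, so there are
  exactly \<open>b\<close> iterations.\<close>

lemma runs_For:
  assumes init: "I 0 (s(i := (s i)(0 := 0)))"
    and bound: "\<And>k s. I k s \<Longrightarrow> s i 0 = k \<and> aval e s = b"
    and step: "\<And>k s. k < b \<Longrightarrow> I k s \<Longrightarrow>
      runs m c s (\<lambda>s'. I (Suc k) (s'(i := (s' i)(0 := Suc (s' i 0)))))"
    and post: "\<And>s. I b s \<Longrightarrow> Q s"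
    and le: "b \<le> m"
  shows "runs m (For i e c) s Q"
proof -
  let ?w = "While (Less (V i) e) (Seq c (Set i (Plus (V i) (N 1))))"
  \<comment> \<open>The body, plus one unit each for the increment and the test.\<close>
  let ?T = "cost m c + 2"
  have loop: "\<exists>t s'. exec ?w s t s' \<and> t \<le> (b - k) * ?T + 1 \<and> Q s'" if "I k s" "k \<le> b" for k s
    using that
  proof (induction "b - k" arbitrary: k s)
    case 0
    then have "\<not> bval (Less (V i) e) s" "I b s" using bound[OF 0(2)] by auto
    then show ?case using 0 post
      by (auto intro!: exI[of _ s] exI[of _ 1] exec.WhileFalse)
  next
    case (Suc d)
    then have "k < b" by simp
    then have cond: "bval (Less (V i) e) s" using bound[OF Suc(3)] by simp
    obtain t s1 where body: "exec c s t s1" "t \<le> cost m c"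
      and I: "I (Suc k) (s1(i := (s1 i)(0 := Suc (s1 i 0))))"
      using step[OF \<open>k < b\<close> Suc(3)] by (auto simp: runs_def)
    have "exec (Set i (Plus (V i) (N 1))) s1 1 (s1(i := (s1 i)(0 := Suc (s1 i 0))))"
      using exec.Assign[of i "N 0" "Plus (V i) (N 1)" s1] by simp
    then have iter: "exec (Seq c (Set i (Plus (V i) (N 1)))) s (t + 1) (s1(i := (s1 i)(0 := Suc (s1 i 0))))"
      using body(1) by (rule exec.Seq[rotated])
    have "\<exists>t s'. exec ?w (s1(i := (s1 i)(0 := Suc (s1 i 0)))) t s' \<and>
        t \<le> (b - Suc k) * ?T + 1 \<and> Q s'"
      using Suc.hyps(2) \<open>k < b\<close> by (intro Suc.hyps(1)[OF _ I]) auto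
    then obtain t' s2 where rest:
      "exec ?w (s1(i := (s1 i)(0 := Suc (s1 i 0)))) t' s2"
      "t' \<le> (b - Suc k) * ?T + 1" "Q s2"
      by blast
    have "exec ?w s (Suc (t + 1 + t')) s2"
      using cond iter rest(1) by (rule exec.WhileTrue)
    moreover have "b - k = Suc (b - Suc k)" using \<open>k < b\<close> by simp
    then have "Suc (t + 1 + t') \<le> (b - k) * ?T + 1"
      using body(2) rest(2) by simp
    ultimately show ?case using rest(3) by blast
  qed
  obtain t s' where w: "exec ?w (s(i := (s i)(0 := 0))) t s'" "t \<le> b * ?T + 1" "Q s'"
    using loop[OF init] by auto
  have "b * ?T \<le> m * ?T" using le by (rule mult_le_mono1)
  with w(2) have "1 + t \<le> cost m (For i e c)" by (simp add: For_def)
  moreover have "exec (For i e c) s (1 + t) s'"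
    unfolding For_def using exec.Assign[of i "N 0" "N 0" s] w(1) by (intro exec.Seq) simp_all
  ultimately show ?thesis unfolding runs_def using w(3) by blast
qed

section \<open>The decision procedure\<close>

lemma nth_rows:
  assumes "i < m" "j < n"
  shows "concat (map (\<lambda>i. map (f i) [0..<n]) [0..<m]) ! (i * n + j) = f i j"
  using assms(1)
proof (induction m)
  case (Suc m)
  let ?r = "\<lambda>m. concat (map (\<lambda>i. map (f i) [0..<n]) [0..<m])"
  have len: "length (?r m) = m * n" by (simp add: length_concat comp_def sum_list_triv)
  show ?case
  proof (cases "i = m")
    case True
    then show ?thesis using len assms(2) by (simp add: nth_append)
  next
    case False
    then have "Suc i \<le> m" using Suc.prems by simp
    then have "Suc i * n \<le> m * n" by (rule mult_le_mono1)
    then have "i * n + j < m * n" using assms(2) by simp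
    then show ?thesis using Suc False len by (simp add: nth_append)
  qed
qed simp

locale matrix_input = pair_graph G for G :: "nat pair_pre_digraph" +
  fixes n :: nat
  assumes verts: "pverts G = {..<n}"
begin

lemma arc_less: "(u, v) \<in> parcs G \<Longrightarrow> u < n" "(u, v) \<in> parcs G \<Longrightarrow> v < n"
  using verts in_arcsD1 in_arcsD2 by auto

lemma adjacency_string_rows:
  "adjacency_string G = concat (map (\<lambda>i. map (\<lambda>j. (i, j) \<in> parcs G) [0..<n]) [0..<n])"
  by (simp add: adjacency_string_def verts)

lemma length_adjacency_string: "length (adjacency_string G) = n * n"
  by (simp add: adjacency_string_rows length_concat comp_def sum_list_triv)

lemma nth_adjacency_string:
  "i < n \<Longrightarrow> j < n \<Longrightarrow> adjacency_string G ! (i * n + j) \<longleftrightarrow> (i, j) \<in> parcs G"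
  by (simp add: adjacency_string_rows nth_rows)

definition has_input :: "state \<Rightarrow> bool" where
  "has_input s \<longleftrightarrow> s ''len'' 0 = n * n \<and>
     (\<forall>i<n. \<forall>j<n. s ''in'' (i * n + j) = of_bool ((i, j) \<in> parcs G))"

text \<open>Row offsets are tabulated because the machine cannot multiply.\<close>

definition has_rows :: "state \<Rightarrow> bool" where
  "has_rows s \<longleftrightarrow> has_input s \<and> s ''n'' 0 = n \<and> (\<forall>i<n. s ''row'' i = i * n)"

definition has_degrees :: "state \<Rightarrow> bool" where
  "has_degrees s \<longleftrightarrow> has_rows s \<and> (\<forall>i<n. s ''deg'' i = deg G i)"

definition has_core :: "state \<Rightarrow> bool" where
  "has_core s \<longleftrightarrow> has_degrees s \<and> (\<forall>i<n. s ''core'' i = of_bool (i \<in> core G))"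

lemma has_input_update [simp]:
  "x \<notin> {''len'', ''in''} \<Longrightarrow> has_input (s(x := f)) \<longleftrightarrow> has_input s"
  by (auto simp: has_input_def)

lemma has_rows_update [simp]:
  "x \<notin> {''len'', ''in'', ''n'', ''row''} \<Longrightarrow> has_rows (s(x := f)) \<longleftrightarrow> has_rows s"
  by (auto simp: has_rows_def)

lemma has_degrees_update [simp]:
  "x \<notin> {''len'', ''in'', ''n'', ''row'', ''deg''} \<Longrightarrow>
     has_degrees (s(x := f)) \<longleftrightarrow> has_degrees s"
  by (auto simp: has_degrees_def)

lemma has_core_update [simp]:
  "x \<notin> {''len'', ''in'', ''n'', ''row'', ''deg'', ''core''} \<Longrightarrow>
     has_core (s(x := f)) \<longleftrightarrow> has_core s"
  by (auto simp: has_core_def)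

lemma has_rowsD: "has_rows s \<Longrightarrow> has_input s \<and> s ''n'' 0 = n \<and> s ''len'' 0 = n * n"
  by (simp add: has_rows_def has_input_def)

lemma has_degreesD:
  "has_degrees s \<Longrightarrow> has_rows s \<and> s ''n'' 0 = n \<and> s ''len'' 0 = n * n \<and>
     (\<forall>i<n. s ''deg'' i = deg G i)"
  by (simp add: has_degrees_def has_rowsD)

lemma has_coreD:
  "has_core s \<Longrightarrow> has_rows s \<and> s ''n'' 0 = n \<and> s ''len'' 0 = n * n \<and>
     (\<forall>i<n. s ''deg'' i = deg G i) \<and> (\<forall>i<n. s ''core'' i = of_bool (i \<in> core G))"
  by (simp add: has_core_def has_degreesD)

end

section \<open>Computing the size, the degrees and the core\<close>

definition Adj :: "vname \<Rightarrow> vname \<Rightarrow> bexp" where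
  "Adj i j = Eq (Rd ''in'' (Plus (Rd ''row'' (V i)) (V j))) (N 1)"

text \<open>The square root of the input length: \<open>sq\<close> is kept equal to the square of
  \<open>n\<close> by adding \<open>2n + 1\<close> whenever \<open>n\<close> grows by 1.\<close>

definition Find_size :: com where
  "Find_size = For ''k'' (V ''len'') (If (Less (V ''sq'') (V ''len''))
     (Seq (Set ''sq'' (Plus (V ''sq'') (Plus (V ''n'') (Plus (V ''n'') (N 1)))))
       (Set ''n'' (Plus (V ''n'') (N 1))))
     Skip)"

definition Find_rows :: com where
  "Find_rows = Seq (Assign ''row'' (N 0) (N 0)) (For ''i'' (V ''n'')
     (Assign ''row'' (Plus (V ''i'') (N 1)) (Plus (Rd ''row'' (V ''i'')) (V ''n''))))"

definition Find_degrees :: com where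
  "Find_degrees = For ''i'' (V ''n'') (Seq (Assign ''deg'' (V ''i'') (N 0))
     (For ''j'' (V ''n'') (If (Adj ''i'' ''j'')
       (Assign ''deg'' (V ''i'') (Plus (Rd ''deg'' (V ''i'')) (N 1))) Skip)))"

definition Find_core :: com where
  "Find_core = For ''i'' (V ''n'') (Seq (Set ''bad'' (N 0)) (Seq
     (For ''j'' (V ''n'') (If (And (Adj ''i'' ''j'') (Eq (Rd ''deg'' (V ''j'')) (N 2)))
       (Set ''bad'' (N 1)) Skip))
     (If (And (Eq (Rd ''deg'' (V ''i'')) (N 3)) (Eq (V ''bad'') (N 0)))
       (Assign ''core'' (V ''i'') (N 1)) (Assign ''core'' (V ''i'') (N 0)))))"

lemma all_less_Suc: "(\<forall>x<Suc k. P x) \<longleftrightarrow> P k \<and> (\<forall>x<k. P x)"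
  by (auto simp: less_Suc_eq)

context matrix_input
begin

lemma n_le_square: "n \<le> n * n"
  by (cases n) auto

lemma bval_Adj:
  assumes "has_rows s" "s i 0 < n" "s j 0 < n"
  shows "bval (Adj i j) s \<longleftrightarrow> (s i 0, s j 0) \<in> parcs G"
  using assms by (simp add: Adj_def has_rows_def has_input_def)

lemma runs_Find_size:
  assumes "has_input s" "s ''n'' 0 = 0" "s ''sq'' 0 = 0"
  shows "runs (n * n) Find_size s (\<lambda>s. has_input s \<and> s ''n'' 0 = n)"
  unfolding Find_size_def
proof (rule runs_For[where I = "\<lambda>k s. has_input s \<and> s ''k'' 0 = k \<and>
    s ''n'' 0 = min k n \<and> s ''sq'' 0 = min k n * min k n" and b = "n * n"])
  fix k s
  assume I: "has_input s \<and> s ''k'' 0 = k \<and> s ''n'' 0 = min k n \<and> s ''sq'' 0 = min k n * min k n"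
  show "s ''k'' 0 = k \<and> aval (V ''len'') s = n * n"
    using I by (simp add: has_input_def)
  have len: "s ''len'' 0 = n * n" using I by (simp add: has_input_def)
  have less: "min k n * min k n < n * n \<longleftrightarrow> k < n"
    by (cases "k < n") (auto simp: min_def mult_strict_mono)
  show "runs (n * n) (If (Less (V ''sq'') (V ''len''))
      (Seq (Set ''sq'' (Plus (V ''sq'') (Plus (V ''n'') (Plus (V ''n'') (N 1)))))
        (Set ''n'' (Plus (V ''n'') (N 1)))) Skip) s
      (\<lambda>s'. has_input (s'(''k'' := (s' ''k'')(0 := Suc (s' ''k'' 0)))) \<and>
        (s'(''k'' := (s' ''k'')(0 := Suc (s' ''k'' 0)))) ''k'' 0 = Suc k \<and>
        (s'(''k'' := (s' ''k'')(0 := Suc (s' ''k'' 0)))) ''n'' 0 = min (Suc k) n \<and>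
        (s'(''k'' := (s' ''k'')(0 := Suc (s' ''k'' 0)))) ''sq'' 0 = min (Suc k) n * min (Suc k) n)"
    using I len less by (intro runs_If runs_Seq runs_Assign runs_Skip) (auto simp: min_def)
qed (use assms n_le_square in \<open>auto simp: min_def\<close>)

lemma runs_Find_rows:
  assumes "has_input s" "s ''n'' 0 = n"
  shows "runs (n * n) Find_rows s has_rows"
  unfolding Find_rows_def
proof (intro runs_Seq runs_Assign, rule runs_For[where b = n and
    I = "\<lambda>k s. has_input s \<and> s ''i'' 0 = k \<and> s ''n'' 0 = n \<and> (\<forall>x\<le>k. s ''row'' x = x * n)"],
    goal_cases)
  case (3 k s)
  then show ?case by (intro runs_Assign) (simp add: le_Suc_eq)
qed (use assms n_le_square in \<open>simp_all add: has_rows_def\<close>)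

lemma runs_Find_degrees:
  assumes "has_rows s"
  shows "runs (n * n) Find_degrees s has_degrees"
  unfolding Find_degrees_def
proof (rule runs_For[where b = n and
    I = "\<lambda>i s. has_rows s \<and> s ''i'' 0 = i \<and> (\<forall>x<i. s ''deg'' x = deg G x)"], goal_cases)
  case outer: (3 i s)
  show ?case
  proof (intro runs_Seq runs_Assign, rule runs_For[where b = n and
      I = "\<lambda>j s. has_rows s \<and> s ''i'' 0 = i \<and> s ''j'' 0 = j \<and> (\<forall>x<i. s ''deg'' x = deg G x) \<and>
        s ''deg'' i = card {w. w < j \<and> (i, w) \<in> parcs G}"], goal_cases)
    case (3 j s)
    then have "bval (Adj ''i'' ''j'') s \<longleftrightarrow> (i, j) \<in> parcs G"
      using bval_Adj[of s "''i''" "''j''"] outer by simp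
    moreover have "{w. w < Suc j \<and> (i, w) \<in> parcs G} = (if (i, j) \<in> parcs G
        then insert j {w. w < j \<and> (i, w) \<in> parcs G} else {w. w < j \<and> (i, w) \<in> parcs G})"
      by (auto simp: less_Suc_eq)
    ultimately show ?case
      using 3 by (intro runs_If runs_Assign runs_Skip) (simp_all add: all_less_Suc)
  next
    case (4 s)
    have "{w. w < n \<and> (i, w) \<in> parcs G} = {w. (i, w) \<in> parcs G}"
      using arc_less by blast
    then show ?case using 4 by (simp add: all_less_Suc deg_def)
  qed (use outer n_le_square in \<open>simp_all add: has_rowsD\<close>)
qed (use assms n_le_square in \<open>simp_all add: has_rowsD has_degrees_def\<close>)

lemma runs_Find_core:
  assumes "has_degrees s"
  shows "runs (n * n) Find_core s has_core"
  unfolding Find_core_def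
proof (rule runs_For[where b = n and
    I = "\<lambda>i s. has_degrees s \<and> s ''i'' 0 = i \<and> (\<forall>x<i. s ''core'' x = of_bool (x \<in> core G))"],
    goal_cases)
  case outer: (3 i s)
  show ?case
  proof (intro runs_Seq runs_Assign, rule runs_For[where b = n and
      I = "\<lambda>j s. has_degrees s \<and> s ''i'' 0 = i \<and> s ''j'' 0 = j \<and>
        (\<forall>x<i. s ''core'' x = of_bool (x \<in> core G)) \<and>
        s ''bad'' 0 = of_bool (\<exists>w<j. (i, w) \<in> parcs G \<and> deg G w = 2)"], goal_cases)
    case (3 j s)
    then show ?case
      using bval_Adj[of s "''i''" "''j''"] outer(1) has_degreesD[of s]
      by (intro runs_If runs_Assign runs_Skip) (auto simp: less_Suc_eq)
  next
    case (4 s)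
    have "i \<in> core G \<longleftrightarrow> deg G i = 3 \<and> \<not> (\<exists>w<n. (i, w) \<in> parcs G \<and> deg G w = 2)"
      using arc_less(2)[of i] outer(1) by (auto simp: core_def verts)
    then show ?case
      using 4 outer(1) has_degreesD[of s]
      by (intro runs_If runs_Assign) (auto simp: less_Suc_eq)
  qed (use outer n_le_square in \<open>simp_all add: has_degreesD\<close>)
qed (use assms n_le_square in \<open>simp_all add: has_degreesD has_core_def\<close>)

end

section \<open>Programs for the colouring and the representatives\<close>

text \<open>The component names and the decision to flip are saved first, since the loop overwrites
  the entries of vertex \<open>i\<close> itself.\<close>

definition Merge :: com where
  "Merge =
     Seq (Set ''a'' (Rd ''comp'' (V ''i'')))
    (Seq (Set ''b'' (Rd ''comp'' (V ''j'')))
    (Seq (If (Eq (Rd ''col'' (V ''i'')) (Rd ''col'' (V ''j''))) (Set ''flip'' (N 1)) (Set ''flip'' (N 0)))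
    (For ''w'' (V ''n'') (If (Eq (Rd ''comp'' (V ''w'')) (V ''a''))
       (Seq (Assign ''comp'' (V ''w'') (V ''b''))
         (If (Eq (V ''flip'') (N 1))
           (Assign ''col'' (V ''w'') (Minus (N 1) (Rd ''col'' (V ''w'')))) Skip))
       Skip))))"

definition Colour :: com where
  "Colour =
     Seq (Set ''out'' (N 1))
    (Seq (For ''i'' (V ''n'') (Seq (Assign ''comp'' (V ''i'') (V ''i'')) (Assign ''col'' (V ''i'') (N 0))))
    (For ''i'' (V ''n'') (For ''j'' (V ''n'')
      (If (And (Adj ''i'' ''j'')
          (And (Not (Eq (Rd ''deg'' (V ''i'')) (N 2))) (Not (Eq (Rd ''deg'' (V ''j'')) (N 2)))))
        (If (Eq (Rd ''comp'' (V ''i'')) (Rd ''comp'' (V ''j'')))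
          (If (Eq (Rd ''col'' (V ''i'')) (Rd ''col'' (V ''j''))) (Set ''out'' (N 0)) Skip)
          Merge)
        Skip))))"

text \<open>\<open>best\<close> is shifted by one, with 0 for no candidate. The negated conjunction
  expresses a disjunction.\<close>

definition Cheapest :: com where
  "Cheapest = Seq (Set ''best'' (N 0)) (For ''v'' (V ''n'')
     (If (And (And (Adj ''u'' ''v'') (Eq (Rd ''deg'' (V ''v'')) (N 3)))
          (Not (And (Not (Eq (V ''best'') (N 0)))
            (Not (Less (Rd ''price'' (V ''v'')) (Rd ''price'' (Minus (V ''best'') (N 1))))))))
       (Set ''best'' (Plus (V ''v'') (N 1))) Skip))"

definition Bid :: com where
  "Bid = Seq Cheapest (If (Eq (V ''best'') (N 0)) Skip
    (Seq (Set ''v'' (Minus (V ''best'') (N 1)))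
    (Seq (Assign ''mate'' (Rd ''own'' (V ''v'')) (N 0))
    (Seq (Assign ''own'' (V ''v'') (Plus (V ''u'') (N 1)))
    (Seq (Assign ''mate'' (Plus (V ''u'') (N 1)) (Plus (V ''v'') (N 1)))
      (Assign ''price'' (V ''v'') (Plus (Rd ''price'' (V ''v'')) (N 1))))))))"

definition Unassigned :: bexp where
  "Unassigned = And (Eq (Rd ''core'' (V ''u'')) (N 1)) (Eq (Rd ''mate'' (Plus (V ''u'') (N 1))) (N 0))"

text \<open>If representatives exist, every round with an unassigned bidder at its start raises the
  total price, which stays below \<open>n * n\<close> while someone is unassigned. So
  \<open>len\<close> rounds suffice.\<close>

definition Auction :: com where
  "Auction =
     Seq (For ''i'' (V ''n'') (Seq (Assign ''own'' (V ''i'') (N 0))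
       (Seq (Assign ''price'' (V ''i'') (N 0)) (Assign ''mate'' (Plus (V ''i'') (N 1)) (N 0)))))
    (For ''t'' (V ''len'') (For ''u'' (V ''n'') (If Unassigned Bid Skip)))"

definition Check :: com where
  "Check = For ''u'' (V ''n'') (If Unassigned (Set ''out'' (N 0)) Skip)"

section \<open>Correctness of the colouring\<close>

context matrix_input
begin

definition odd_edges :: "(nat \<times> nat) set" where
  "odd_edges = {(u, v) \<in> parcs G. deg G u \<noteq> 2 \<and> deg G v \<noteq> 2}"

lemma odd_edges_less: "odd_edges \<subseteq> {..<n} \<times> {..<n}"
  using arc_less by (auto simp: odd_edges_def)

lemma proper_colouring_odd_edges: "proper_colouring odd_edges c \<longleftrightarrow> sign_colouring G c"
  by (auto simp: proper_colouring_def sign_colouring_def odd_edges_def)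

lemma runs_Merge:
  assumes s: "has_core s" "s ''i'' 0 = u" "s ''j'' 0 = v" "s ''out'' 0 = x" and uv: "u < n" "v < n"
    and KL: "s ''comp'' = K" "s ''col'' = L"
  shows "runs (n * n) Merge s (\<lambda>s. has_core s \<and> s ''i'' 0 = u \<and> s ''j'' 0 = v \<and> s ''out'' 0 = x \<and>
    (\<forall>y<n. s ''comp'' y = (if K y = K u then K v else K y)) \<and>
    (\<forall>y<n. s ''col'' y = (if K y = K u \<and> L u = L v then 1 - L y else L y)))"
proof -
  let ?I = "\<lambda>w s. has_core s \<and> s ''i'' 0 = u \<and> s ''j'' 0 = v \<and> s ''out'' 0 = x \<and> s ''w'' 0 = w \<and>
    s ''a'' 0 = K u \<and> s ''b'' 0 = K v \<and> s ''flip'' 0 = of_bool (L u = L v) \<and>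
    (\<forall>y<n. s ''comp'' y = (if y < w \<and> K y = K u then K v else K y)) \<and>
    (\<forall>y<n. s ''col'' y = (if y < w \<and> K y = K u \<and> L u = L v then 1 - L y else L y))"
  have "runs (n * n) (For ''w'' (V ''n'') (If (Eq (Rd ''comp'' (V ''w'')) (V ''a''))
       (Seq (Assign ''comp'' (V ''w'') (V ''b''))
         (If (Eq (V ''flip'') (N 1))
           (Assign ''col'' (V ''w'') (Minus (N 1) (Rd ''col'' (V ''w'')))) Skip))
       Skip)) s' (?I n)" if "?I 0 (s'(''w'' := (s' ''w'')(0 := 0)))" for s'
    using that
  proof (rule runs_For[where I = ?I and b = n], goal_cases)
    case (2 w s)
    then show ?case
      by (intro runs_If runs_Seq runs_Assign runs_Skip) (auto simp: less_Suc_eq)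
  qed (use n_le_square in \<open>simp_all add: has_coreD\<close>)
  note loop = runs_mono[OF this]
  show ?thesis unfolding Merge_def
    by (intro runs_Seq runs_If runs_Assign loop) (use s uv KL in simp_all)
qed

definition processed :: "nat \<Rightarrow> nat \<Rightarrow> (nat \<times> nat) set" where
  "processed i j = {(u, v) \<in> odd_edges. u < i \<or> u = i \<and> v < j}"

lemma processed_simps:
  "processed 0 0 = {}" "processed i n = processed (Suc i) 0" "processed n 0 = odd_edges"
  "processed i (Suc j) = (if (i, j) \<in> odd_edges then insert (i, j) (processed i j) else processed i j)"
  using odd_edges_less by (auto simp: processed_def less_Suc_eq)

text \<open>Once a conflict has occurred, only the impossibility of a colouring is recorded, and
  nothing about \<open>comp\<close> and \<open>col\<close>.\<close>

definition colouring_inv :: "(nat \<times> nat) set \<Rightarrow> state \<Rightarrow> bool" where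
  "colouring_inv F s \<longleftrightarrow> has_core s \<and>
     (s ''out'' 0 = 1 \<and> parity_structure n F (s ''comp'') (s ''col'') \<or>
      s ''out'' 0 = 0 \<and> (\<forall>c. \<not> proper_colouring odd_edges c))"

lemma colouring_inv_update [simp]:
  "x \<notin> {''len'', ''in'', ''n'', ''row'', ''deg'', ''core'', ''out'', ''comp'', ''col''} \<Longrightarrow>
     colouring_inv F (s(x := f)) \<longleftrightarrow> colouring_inv F s"
  by (auto simp: colouring_inv_def)

lemma runs_Colour:
  assumes "has_core s"
  shows "runs (n * n) Colour s (\<lambda>s. has_core s \<and> s ''out'' 0 = of_bool (\<exists>c. sign_colouring G c))"
proof -
  have init: "runs (n * n)
      (For ''i'' (V ''n'') (Seq (Assign ''comp'' (V ''i'') (V ''i'')) (Assign ''col'' (V ''i'') (N 0))))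
      s (colouring_inv {})" if "has_core s" "s ''out'' 0 = 1" for s
  proof (rule runs_For[where b = n and I = "\<lambda>k s. has_core s \<and> s ''i'' 0 = k \<and> s ''out'' 0 = 1 \<and>
      (\<forall>x<k. s ''comp'' x = x \<and> s ''col'' x = 0)"], goal_cases)
    case (3 k s)
    then show ?case by (intro runs_Seq runs_Assign) (simp add: less_Suc_eq)
  qed (use that n_le_square in \<open>simp_all add: has_coreD colouring_inv_def parity_structure_empty\<close>)
  have loop: "runs (n * n) (For ''i'' (V ''n'') (For ''j'' (V ''n'')
      (If (And (Adj ''i'' ''j'')
          (And (Not (Eq (Rd ''deg'' (V ''i'')) (N 2))) (Not (Eq (Rd ''deg'' (V ''j'')) (N 2)))))
        (If (Eq (Rd ''comp'' (V ''i'')) (Rd ''comp'' (V ''j'')))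
          (If (Eq (Rd ''col'' (V ''i'')) (Rd ''col'' (V ''j''))) (Set ''out'' (N 0)) Skip)
          Merge)
        Skip))) s (colouring_inv odd_edges)" if "colouring_inv {} s" for s
  proof (rule runs_For[where b = n and I = "\<lambda>i s. colouring_inv (processed i 0) s \<and> s ''i'' 0 = i"],
      goal_cases)
    case outer: (3 i s)
    show ?case
    proof (rule runs_For[where b = n and
        I = "\<lambda>j s. colouring_inv (processed i j) s \<and> s ''i'' 0 = i \<and> s ''j'' 0 = j"], goal_cases)
      case (3 j s)
      let ?K = "s ''comp''" and ?L = "s ''col''"
      have core: "has_core s" using 3 by (simp add: colouring_inv_def)
      have ij: "s ''i'' 0 = i" "s ''j'' 0 = j" "i < n" "j < n" using 3 outer by auto
      have test: "bval (And (Adj ''i'' ''j'') (And (Not (Eq (Rd ''deg'' (V ''i'')) (N 2)))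
          (Not (Eq (Rd ''deg'' (V ''j'')) (N 2))))) s \<longleftrightarrow> (i, j) \<in> odd_edges"
        using bval_Adj[of s "''i''" "''j''"] ij has_coreD[OF core] by (simp add: odd_edges_def)
      have sub: "processed i j \<subseteq> {..<n} \<times> {..<n}" using odd_edges_less by (auto simp: processed_def)
      have subA: "insert (i, j) (processed i j) \<subseteq> odd_edges" if "(i, j) \<in> odd_edges"
        using that by (auto simp: processed_def)
      have inv: "colouring_inv (processed i j) s" using 3 by simp
      have merge: "runs (n * n) Merge s (\<lambda>s. colouring_inv (processed i (Suc j)) s \<and>
          s ''i'' 0 = i \<and> s ''j'' 0 = j)" if "(i, j) \<in> odd_edges" "?K i \<noteq> ?K j"
      proof (rule runs_mono, rule runs_Merge[OF core ij(1,2) refl ij(3,4) refl refl], goal_cases)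
        case (1 t)
        have "parity_structure n (insert (i, j) (processed i j)) (t ''comp'') (t ''col'')"
          if "parity_structure n (processed i j) ?K ?L"
          by (rule parity_structure_insert_merge[OF that sub ij(3,4) \<open>?K i \<noteq> ?K j\<close>]) (use 1 in simp_all)
        then show ?case using 1 inv \<open>(i, j) \<in> odd_edges\<close> by (auto simp: colouring_inv_def processed_simps)
      qed
      have conflict: "\<not> proper_colouring odd_edges c"
        if "(i, j) \<in> odd_edges" "?K i = ?K j" "?L i = ?L j" "parity_structure n (processed i j) ?K ?L" for c
        by (rule parity_structure_conflict[OF that(4) ij(3,4) that(2,3) subA[OF that(1)]])
      show ?case
      proof (rule runs_mono[where Q = "\<lambda>s. colouring_inv (processed i (Suc j)) s \<and>
          s ''i'' 0 = i \<and> s ''j'' 0 = j"], rule runs_If, unfold test, goal_cases)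
        case A: 1
        show ?case
        proof (rule runs_If, goal_cases)
          case 1
          then have K: "?K i = ?K j" using ij by simp
          show ?case
          proof (rule runs_If, goal_cases)
            case 1
            then have "?L i = ?L j" using ij by simp
            then have "\<not> proper_colouring odd_edges c" for c
              using conflict[OF A K] inv by (auto simp: colouring_inv_def)
            with core ij show ?case by (intro runs_Assign) (simp add: colouring_inv_def)
          next
            case 2
            then have "?L i \<noteq> ?L j" using ij by simp
            then have "colouring_inv (processed i (Suc j)) s"
              using inv K A
              by (auto simp: colouring_inv_def processed_simps parity_structure_insert_same)
            with ij show ?case by (intro runs_Skip) simp
          qed
        next
          case 2
          with A ij show ?case by (intro merge) simp_all
        qed
      next
        case 2
        with 3 show ?case by (intro runs_Skip) (simp add: processed_simps)
      qed simp
    qed (use outer n_le_square in \<open>simp_all add: has_coreD colouring_inv_def processed_simps\<close>)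
  qed (use that n_le_square in \<open>simp_all add: has_coreD colouring_inv_def processed_simps\<close>)
  have result: "has_core s \<and> s ''out'' 0 = of_bool (\<exists>c. sign_colouring G c)"
    if "colouring_inv odd_edges s" for s
    using that parity_structure_imp_proper_colouring[OF _ odd_edges_less]
    by (auto simp: colouring_inv_def proper_colouring_odd_edges)
  show ?thesis
    unfolding Colour_def
    by (intro runs_Seq runs_Assign, rule runs_mono[OF init], use assms in simp, use assms in simp,
        rule runs_mono[OF loop result])
qed

end

definition Decide :: com where
  "Decide = Seq Find_size (Seq Find_rows (Seq Find_degrees (Seq Find_core
     (Seq Colour (Seq Auction Check)))))"

section \<open>Correctness of the auction\<close>

context matrix_input
begin

definition accepts :: "nat \<Rightarrow> nat \<Rightarrow> bool" where
  "accepts u v \<longleftrightarrow> (u, v) \<in> parcs G \<and> deg G v = 3"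

sublocale auction n "core G" accepts
  by unfold_locales (auto simp: core_def verts accepts_def arc_less)

lemma core_representatives_iff: "core_representatives G f \<longleftrightarrow> assignment (core G) accepts f"
  by (simp add: core_representatives_def assignment_def accepts_def)

text \<open>\<open>P\<close> carries along arbitrary facts that do not depend on \<open>v\<close>
  and \<open>best\<close>.\<close>

lemma runs_Cheapest:
  assumes s: "has_core s" "s ''u'' 0 = u" "u < n"
    and P: "\<And>s x f. x \<in> {''v'', ''best''} \<Longrightarrow> P (s(x := f)) \<longleftrightarrow> P s" "P s"
    and price: "s ''price'' = p"
  shows "runs (n * n) Cheapest s (\<lambda>s. has_core s \<and> s ''u'' 0 = u \<and> P s \<and> s ''price'' = p \<and>
    (case s ''best'' 0 of 0 \<Rightarrow> \<forall>w. \<not> accepts u w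
     | Suc v \<Rightarrow> accepts u v \<and> (\<forall>w. accepts u w \<longrightarrow> p v \<le> p w)))"
  unfolding Cheapest_def
proof (intro runs_Seq runs_Assign, rule runs_For[where b = n and
    I = "\<lambda>k s. has_core s \<and> s ''u'' 0 = u \<and> P s \<and> s ''price'' = p \<and> s ''v'' 0 = k \<and>
    (case s ''best'' 0 of 0 \<Rightarrow> \<forall>w<k. \<not> accepts u w
     | Suc v \<Rightarrow> accepts u v \<and> (\<forall>w<k. accepts u w \<longrightarrow> p v \<le> p w))"], goal_cases)
  case (3 k s)
  then have "bval (Adj ''u'' ''v'') s \<longleftrightarrow> (u, k) \<in> parcs G"
    using bval_Adj[of s "''u''" "''v''"] s(3) has_coreD[of s] by simp
  then have test: "bval (And (Adj ''u'' ''v'') (Eq (Rd ''deg'' (V ''v'')) (N 3))) s \<longleftrightarrow> accepts u k"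
    using 3 has_coreD[of s] by (simp add: accepts_def)
  show ?case
  proof (cases "s ''best'' 0")
    case 0
    then show ?thesis
      using 3 test by (intro runs_If runs_Assign runs_Skip) (auto simp: less_Suc_eq P(1))
  next
    case (Suc v)
    then show ?thesis
      using 3 test by (intro runs_If runs_Assign runs_Skip) (auto simp: less_Suc_eq P(1))
  qed
next
  case (4 s)
  have "accepts u w \<Longrightarrow> w < n" for w by (rule R_less)
  then show ?case using 4 by (auto split: nat.splits)
qed (use s P price n_le_square in \<open>simp_all add: has_coreD P(1)\<close>)

abbreviation feasible :: bool where
  "feasible \<equiv> \<exists>f. assignment (core G) accepts f"

text \<open>The bound on prices is conditional: it rests on comparing with an existing
  assignment.\<close>

definition auction_state :: "state \<Rightarrow> bool" where
  "auction_state s \<longleftrightarrow> has_core s \<and>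
     auction_inv n (core G) accepts (s ''own'') (s ''mate'') (s ''price'') \<and>
     (feasible \<longrightarrow> (\<forall>v<n. s ''price'' v \<le> n))"

definition all_assigned :: "state \<Rightarrow> bool" where
  "all_assigned s \<longleftrightarrow> (\<forall>u\<in>core G. s ''mate'' (Suc u) \<noteq> 0)"

definition total_price :: "state \<Rightarrow> nat" where
  "total_price s = (\<Sum>v<n. s ''price'' v)"

lemma auction_updates [simp]:
  "x \<notin> {''len'', ''in'', ''n'', ''row'', ''deg'', ''core'', ''own'', ''mate'', ''price''} \<Longrightarrow>
     auction_state (s(x := f)) \<longleftrightarrow> auction_state s"
  "x \<noteq> ''mate'' \<Longrightarrow> all_assigned (s(x := f)) \<longleftrightarrow> all_assigned s"
  "x \<noteq> ''price'' \<Longrightarrow> total_price (s(x := f)) = total_price s"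
  by (auto simp: auction_state_def all_assigned_def total_price_def)

lemma bval_Unassigned:
  assumes "has_core s" "s ''u'' 0 < n"
  shows "bval Unassigned s \<longleftrightarrow> s ''u'' 0 \<in> core G \<and> s ''mate'' (Suc (s ''u'' 0)) = 0"
  using assms has_coreD[of s] by (simp add: Unassigned_def)

text \<open>The cheapest object costs no more than \<open>f u\<close> for any assignment
  \<open>f\<close>, hence less than \<open>n\<close>, and after the bid at most \<open>n\<close>. If
  \<open>u\<close> accepts no object, no assignment exists.\<close>

lemma runs_Bid:
  assumes s: "auction_state s" "s ''u'' 0 = u" "s ''t'' 0 = t" "s ''out'' 0 = x"
    and u: "u \<in> core G" "s ''mate'' (Suc u) = 0" and total: "total_price s = q"
  shows "runs (n * n) Bid s (\<lambda>s. auction_state s \<and> s ''u'' 0 = u \<and> s ''t'' 0 = t \<and> s ''out'' 0 = x \<and>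
    (feasible \<longrightarrow> total_price s = Suc q))"
proof -
  let ?P = "\<lambda>s'. s' ''own'' = s ''own'' \<and> s' ''mate'' = s ''mate'' \<and> s' ''t'' 0 = t \<and> s' ''out'' 0 = x"
  let ?p = "s ''price''"
  have core: "has_core s" and inv: "auction_inv n (core G) accepts (s ''own'') (s ''mate'') ?p"
    and price: "feasible \<Longrightarrow> v < n \<Longrightarrow> ?p v \<le> n" for v
    using s(1) by (auto simp: auction_state_def)
  show ?thesis
    unfolding Bid_def
  proof (intro runs_Seq, rule runs_mono, 
      rule runs_Cheapest[OF core s(2) U_less[OF u(1)], where P = ?P and p = ?p],
      goal_cases)
    case (4 r)
    show ?case
    proof (cases "r ''best'' 0")
      case 0
      then have none: "\<not> feasible" using 4 u(1) by (auto simp: assignment_def)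
      have "auction_state r" using 4 s(1) by (auto simp: auction_state_def)
      with 0 none 4 show ?thesis by (intro runs_If runs_Skip) auto
    next
      case (Suc v)
      then have v: "accepts u v" "\<And>w. accepts u w \<Longrightarrow> ?p v \<le> ?p w" and vn: "v < n"
        using 4 R_less by auto
      have less: "?p v < n" if f: "assignment (core G) accepts f" for f
      proof -
        have "accepts u (f u)" using f u(1) by (simp add: assignment_def)
        then show ?thesis using v(2) price_less[OF inv f u] by (meson le_less_trans)
      qed
      have "(\<Sum>w<n. (?p(v := Suc (?p v))) w) = Suc (\<Sum>w<n. ?p w)"
        using vn by (simp add: sum.remove[of _ v])
      with Suc 4 total auction_inv_bid[OF inv u v] price less show ?thesis
        by (intro runs_If runs_Seq runs_Assign)
          (auto simp: auction_state_def total_price_def Suc_le_eq)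
    qed
  qed (use s in auto)
qed

lemma runs_Auction:
  assumes "has_core s" "s ''out'' 0 = x"
  shows "runs (n * n) Auction s (\<lambda>s. has_core s \<and> s ''out'' 0 = x \<and> (all_assigned s \<longleftrightarrow> feasible))"
proof -
  have init: "runs (n * n) (For ''i'' (V ''n'') (Seq (Assign ''own'' (V ''i'') (N 0))
       (Seq (Assign ''price'' (V ''i'') (N 0)) (Assign ''mate'' (Plus (V ''i'') (N 1)) (N 0))))) s
      (\<lambda>s. auction_state s \<and> s ''out'' 0 = x)"
  proof (rule runs_For[where b = n and I = "\<lambda>k s. has_core s \<and> s ''i'' 0 = k \<and> s ''out'' 0 = x \<and>
      (\<forall>y<k. s ''own'' y = 0 \<and> s ''price'' y = 0 \<and> s ''mate'' (Suc y) = 0)"], goal_cases)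
    case (3 k s)
    then show ?case by (intro runs_Seq runs_Assign) (simp add: less_Suc_eq)
  next
    case (4 s)
    then show ?case using U_less by (auto simp: auction_state_def auction_inv_def)
  qed (use assms n_le_square in \<open>simp_all add: has_coreD\<close>)
  have loop: "runs (n * n) (For ''t'' (V ''len'') (For ''u'' (V ''n'') (If Unassigned Bid Skip))) s
      (\<lambda>s. auction_state s \<and> s ''out'' 0 = x \<and>
        (feasible \<longrightarrow> all_assigned s \<or> n * n \<le> total_price s))"
    if "auction_state s \<and> s ''out'' 0 = x" for s
  proof (rule runs_For[where b = "n * n" and I = "\<lambda>t s. auction_state s \<and> s ''out'' 0 = x \<and>
      s ''t'' 0 = t \<and> (feasible \<longrightarrow> all_assigned s \<or> t \<le> total_price s)"], goal_cases)
    case outer: (3 t s)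
    \<comment> \<open>Either a bid in this round has already raised the total, or all bidders
      scanned so far are assigned. A bid may displace an earlier bidder, but then the first
      alternative holds.\<close>
    show ?case
    proof (rule runs_For[where b = n and I = "\<lambda>u s. auction_state s \<and> s ''out'' 0 = x \<and>
      s ''t'' 0 = t \<and> s ''u'' 0 = u \<and> (feasible \<longrightarrow> Suc t \<le> total_price s \<or>
        (all_assigned s \<or> t \<le> total_price s) \<and>
        (\<forall>y\<in>core G. y < u \<longrightarrow> s ''mate'' (Suc y) \<noteq> 0))"], goal_cases)
      case (3 u s)
      then have core: "has_core s" by (simp add: auction_state_def)
      have test: "bval Unassigned s \<longleftrightarrow> u \<in> core G \<and> s ''mate'' (Suc u) = 0"
        using bval_Unassigned[OF core] 3 by simp
      show ?case
      proof (rule runs_If, unfold test, goal_cases)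
        case 1
        then have "\<not> all_assigned s" by (auto simp: all_assigned_def)
        then have "feasible \<longrightarrow> t \<le> total_price s" using 3 by auto
        with 1 3 show ?case
          by (intro runs_mono[OF runs_Bid[of s u t x]]) auto
      next
        case 2
        with 3 show ?case by (intro runs_Skip) (auto simp: less_Suc_eq)
      qed
    next
      case (4 s)
      then show ?case using U_less by (auto simp: all_assigned_def)
    qed (use outer n_le_square in \<open>auto simp: auction_state_def has_coreD\<close>)
  qed (use that in \<open>auto simp: auction_state_def has_coreD\<close>)
  have result: "has_core s \<and> s ''out'' 0 = x \<and> (all_assigned s \<longleftrightarrow> feasible)"
    if s: "auction_state s \<and> s ''out'' 0 = x \<and>
      (feasible \<longrightarrow> all_assigned s \<or> n * n \<le> total_price s)" for s
  proof -
    have inv: "auction_inv n (core G) accepts (s ''own'') (s ''mate'') (s ''price'')"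
      using s by (simp add: auction_state_def)
    have "feasible" if "all_assigned s"
      using assignment_of_mates[OF inv] that by (simp add: all_assigned_def)
    moreover have "all_assigned s" if feasible
    proof (rule ccontr)
      assume "\<not> all_assigned s"
      then obtain u where "u \<in> core G" "s ''mate'' (Suc u) = 0" by (auto simp: all_assigned_def)
      then have "total_price s < n * n"
        unfolding total_price_def using s that
        by (intro sum_price_less[OF inv]) (auto simp: auction_state_def)
      then show False using s that \<open>\<not> all_assigned s\<close> by simp
    qed
    ultimately show ?thesis using s by (auto simp: auction_state_def)
  qed
  show ?thesis
    unfolding Auction_def
    by (rule runs_then[OF init], rule runs_mono[OF loop result])
qed

lemma runs_Check:
  assumes "has_core s" "s ''out'' 0 = of_bool P"
  shows "runs (n * n) Check s (\<lambda>s'. s' ''out'' 0 = of_bool (P \<and> all_assigned s))"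
  unfolding Check_def
proof (rule runs_For[where b = n and I = "\<lambda>u s'. has_core s' \<and> s' ''mate'' = s ''mate'' \<and>
    s' ''u'' 0 = u \<and> s' ''out'' 0 = of_bool (P \<and> (\<forall>y\<in>core G. y < u \<longrightarrow> s ''mate'' (Suc y) \<noteq> 0))"],
    goal_cases)
  case (3 u s')
  then show ?case
    using bval_Unassigned[of s'] by (intro runs_If runs_Assign runs_Skip) (auto simp: less_Suc_eq)
next
  case (4 s')
  then show ?case using U_less by (auto simp: all_assigned_def)
qed (use assms n_le_square in \<open>auto simp: has_coreD\<close>)

section \<open>The whole procedure and its running time\<close>

lemma has_input_input_state: "has_input (input_state (adjacency_string G))"
proof -
  have "i * n + j < n * n" if "i < n" "j < n" for i j
  proof -
    have "Suc i * n \<le> n * n" using that(1) by (intro mult_le_mono1) simp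
    then show ?thesis using that(2) by simp
  qed
  then show ?thesis
    by (simp add: has_input_def input_state_def length_adjacency_string nth_adjacency_string)
qed

lemma runs_Decide:
  "runs (n * n) Decide (input_state (adjacency_string G))
     (\<lambda>s. s ''out'' 0 = of_bool ((\<exists>c. sign_colouring G c) \<and> (\<exists>f. core_representatives G f)))"
  unfolding Decide_def
  apply (rule runs_then[OF runs_Find_size[OF has_input_input_state]])
    apply (simp_all add: input_state_def)[2]
  apply (elim conjE, rule runs_then[OF runs_Find_rows], assumption+)
  apply (erule runs_then[OF runs_Find_degrees])
  apply (erule runs_then[OF runs_Find_core])
  apply (erule runs_then[OF runs_Colour])
  apply (elim conjE, rule runs_then[OF runs_Auction], assumption+)
  apply (elim conjE, rule runs_mono[OF runs_Check], assumption+)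
  apply (simp add: core_representatives_iff)
  done

end

theorem theorem3:
  shows "poly_time_decidable_on adjacency_string
           {G. input_graph G \<and> max_degree G = 3}
           (\<lambda>G. in_out_proper_orientation_number G \<le> 2)"
proof -
  \<comment> \<open>The bound \<open>n * n\<close> on the iterations of each loop is the length of
    the input, so this polynomial serves all graphs.\<close>
  obtain p where p: "\<forall>m. cost m Decide = poly p m" using cost_poly by blast
  have "\<exists>t s. exec Decide (input_state (adjacency_string G)) t s \<and>
      t \<le> poly p (length (adjacency_string G)) \<and>
      (accepting s \<longleftrightarrow> in_out_proper_orientation_number G \<le> 2)"
    if G: "input_graph G" "max_degree G = 3" for G
  proof -
    obtain n where n: "pair_graph G" "pverts G = {..<n}" using G(1) by (auto simp: input_graph_def)
    interpret matrix_input G n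
      using n by (simp add: matrix_input_def matrix_input_axioms_def)
    from runs_Decide obtain t s where
      "exec Decide (input_state (adjacency_string G)) t s" "t \<le> cost (n * n) Decide"
      "s ''out'' 0 = of_bool ((\<exists>c. sign_colouring G c) \<and> (\<exists>f. core_representatives G f))"
      unfolding runs_def by blast
    then show ?thesis
      unfolding orientation_number_le_2_iff[OF G(2)] accepting_def length_adjacency_string p[rule_format, symmetric]
      by (intro exI[of _ t] exI[of _ s]) simp
  qed
  then show ?thesis unfolding poly_time_decidable_on_def by blast
qed

end
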